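(* Let $p,q$ be positive integers, let $a\in M_{p\times q}(\mathbb N)$ be an admissible matrix (all its row sums and all its column sums are even), and put $k=\frac12\sum_{i,j}a_{ij}$. Then every pole of $I(a)$, viewed as a rational function of $n$, belongs to the set of integers $$\{-2k,\,-(2k-1),\,\ldots,\,k-2,\,k-1\}.$$
   Context: $\mathbb N=\{0,1,2,\ldots\}$. $O_n$ is the group of real orthogonal $n\times n$ matrices $u=(u_{ij})$, and $du$ is its normalized (probability) Haar measure. For $n\ge\max(p,q)$ put $I(a)=\int_{O_n}\prod_{i=1}^p\prod_{j=1}^q u_{ij}^{a_{ij}}\,du$. For fixed $a$, the value of $I(a)$ for all sufficiently large integers $n$ is given by a (necessarily unique) rational function in $\mathbb Q(n)$; "$I(a)$ viewed as a rational function of $n$" means this rational function. *)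

theory Defs
  imports
    "HOL-Probability.Probability"
    "HOL-Complex_Analysis.Complex_Analysis"
    "HOL-Computational_Algebra.Computational_Algebra"
    "HOL-Computational_Algebra.Field_as_Ring"
    "Jordan_Normal_Form.Matrix"
begin

text \<open>Since the size \<open>n\<close> varies, matrices are those of Jordan_Normal_Form, where rows and
  columns are numbered from \<open>0\<close>. The constant \<open>orthogonal_mat\<close> of that library only asks for
  pairwise orthogonal nonzero columns, so it does not describe \<open>O\<^sub>n\<close>.\<close>

definition orthogonal_group :: "nat \<Rightarrow> real mat set" where
  "orthogonal_group n =
     {u \<in> carrier_mat n n. u * transpose_mat u = 1\<^sub>m n \<and> transpose_mat u * u = 1\<^sub>m n}"

text \<open>The Borel \<open>\<sigma>\<close>-algebra of \<open>O\<^sub>n\<close> as a subspace of \<open>\<real>\<^bsup>n\<times>n\<^esup>\<close>: it is pulled back along the map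
  sending a matrix to its family of entries.\<close>

definition orthogonal_borel :: "nat \<Rightarrow> real mat measure" where
  "orthogonal_borel n =
     vimage_algebra (orthogonal_group n)
       (\<lambda>u. restrict (\<lambda>ij. u $$ ij) ({..<n} \<times> {..<n}))
       (Pi\<^sub>M ({..<n} \<times> {..<n}) (\<lambda>_. borel))"

text \<open>Left invariance suffices to characterise the measure: the group is compact, so the
  normalized left Haar measure is unique and also right invariant.\<close>

definition normalized_haar :: "nat \<Rightarrow> real mat measure \<Rightarrow> bool" where
  "normalized_haar n \<mu> \<longleftrightarrow>
     prob_space \<mu> \<and> sets \<mu> = sets (orthogonal_borel n) \<and>
     (\<forall>g \<in> orthogonal_group n. distr \<mu> \<mu> (\<lambda>u. g * u) = \<mu>)"

text \<open>The integral \<open>I(a)\<close>; \<open>\<mu>\<close> is meant to be the normalized Haar measure on \<open>O\<^sub>n\<close> with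
  \<open>n \<ge> max (dim_row a) (dim_col a)\<close>.\<close>

definition haar_moment :: "real mat measure \<Rightarrow> nat mat \<Rightarrow> real" where
  "haar_moment \<mu> a =
     (LINT u|\<mu>. (\<Prod>i<dim_row a. \<Prod>j<dim_col a. (u $$ (i, j)) ^ (a $$ (i, j))))"

definition admissible :: "nat mat \<Rightarrow> bool" where
  "admissible a \<longleftrightarrow>
     (\<forall>i<dim_row a. even (\<Sum>j<dim_col a. a $$ (i, j))) \<and>
     (\<forall>j<dim_col a. even (\<Sum>i<dim_row a. a $$ (i, j)))"

text \<open>Rational functions over \<open>\<rat>\<close> are elements of the fraction field of \<open>\<rat>[n]\<close>, evaluated at
  complex points. As \<open>quot_of_fract\<close> yields a fraction in lowest terms, the denominator vanishes
  exactly at the poles.\<close>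

definition ratfun_eval :: "rat poly fract \<Rightarrow> complex \<Rightarrow> complex" where
  "ratfun_eval r z =
     poly (map_poly of_rat (fst (quot_of_fract r))) z /
     poly (map_poly of_rat (snd (quot_of_fract r))) z"

text \<open>\<open>I(a)\<close> viewed as a rational function of \<open>n\<close>, where \<open>\<mu> n\<close> is the Haar measure on \<open>O\<^sub>n\<close>.\<close>

definition haar_moment_ratfun :: "(nat \<Rightarrow> real mat measure) \<Rightarrow> nat mat \<Rightarrow> rat poly fract" where
  "haar_moment_ratfun \<mu> a =
     (THE r. \<forall>\<^sub>F n in sequentially.
        ratfun_eval r (of_nat n) = complex_of_real (haar_moment (\<mu> n) a))"

end

theory Submission
  imports Defs "HOL-Library.Function_Algebras"
begin

text \<open>Differentiating the invariance of the Haar measure under plane rotations gives, for moments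
  \<open>F(i; j) = \<integral> \<Prod>\<^sub>s u(i\<^sub>s, j\<^sub>s) du\<close> over a set \<open>S\<close> of \<open>2k\<close> positions and any \<open>x \<in> S\<close>, the equation
  \<open>(n - 1 + J) F = G\<close>. Here \<open>J\<close> is the Jucys--Murphy element, the sum of the transpositions
  \<open>(x m)\<close> with \<open>m \<in> S - {x}\<close>, acting on \<open>j\<close>, and \<open>G\<close> consists of moments over the sets \<open>S - {x, m}\<close>.
  The equation has only one solution for large \<open>n\<close>, and by induction there is one of the form
  \<open>F(i; j) = \<Sum>\<^sub>\<sigma> V(\<sigma>)\<close>, where \<open>\<sigma>\<close> runs through the perfect matchings of \<open>S\<close> whose pairs \<open>j\<close> respects,
  so \<open>J\<close> may be inverted on functions of matchings. There \<open>J\<close> is killed by a product of factors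
  \<open>J - c\<close> with integers \<open>\<bar>c\<bar> \<le> 2k - 1\<close>, and \<open>J \<ge> 2 - k\<close>, so only \<open>c \<ge> 2 - k\<close> occur. Each step
  thus divides by factors \<open>n - (1 - c)\<close> with \<open>2 - 2k \<le> 1 - c \<le> k - 1\<close>.\<close>

section \<open>Rational functions with prescribed poles\<close>

abbreviation cpoly :: "rat poly \<Rightarrow> complex poly" where
  "cpoly \<equiv> map_poly of_rat"

lemma poly_cpoly_pCons [simp]: "poly (cpoly (pCons a p)) z = of_rat a + z * poly (cpoly p) z"
  by (simp add: map_poly_pCons)

lemma poly_cpoly_add [simp]: "poly (cpoly (p + q)) z = poly (cpoly p) z + poly (cpoly q) z"
proof -
  have "cpoly (p + q) = cpoly p + cpoly q"
    by (intro poly_eqI) (simp add: coeff_map_poly of_rat_add)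
  then show ?thesis by simp
qed

lemma poly_cpoly_smult [simp]: "poly (cpoly (Polynomial.smult a p)) z = of_rat a * poly (cpoly p) z"
  by (induction p) (simp_all add: of_rat_mult algebra_simps)

lemma poly_cpoly_mult [simp]: "poly (cpoly (p * q)) z = poly (cpoly p) z * poly (cpoly q) z"
  by (induction p) (simp_all add: algebra_simps)

lemma poly_cpoly_uminus [simp]: "poly (cpoly (- p)) z = - poly (cpoly p) z"
  using poly_cpoly_smult[of "- 1" p z] by (simp add: of_rat_minus)

lemma poly_cpoly_diff [simp]: "poly (cpoly (p - q)) z = poly (cpoly p) z - poly (cpoly q) z"
  using poly_cpoly_add[of p "- q" z] by simp

lemma cpoly_eq_0_iff [simp]: "cpoly p = 0 \<longleftrightarrow> p = 0"
  by (rule map_poly_eq_0_iff) auto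

lemma eventually_poly_cpoly_nonzero:
  assumes "p \<noteq> 0"
  shows "\<forall>\<^sub>F n in sequentially. poly (cpoly p) (of_nat n) \<noteq> 0"
proof -
  have "finite {z. poly (cpoly p) z = 0}"
    using assms by (intro poly_roots_finite) simp
  then have "finite (of_nat -` {z. poly (cpoly p) z = 0} :: nat set)"
    by (rule finite_vimageI) (simp add: inj_def)
  then show ?thesis
    by (simp add: vimage_def eventually_cofinite flip: cofinite_eq_sequentially)
qed

definition rational_with_poles_in :: "int set \<Rightarrow> (nat \<Rightarrow> real) \<Rightarrow> bool" where
  "rational_with_poles_in B f \<longleftrightarrow>
     (\<exists>P Q. Q \<noteq> 0 \<and> (\<forall>z. poly (cpoly Q) z = 0 \<longrightarrow> z \<in> of_int ` B) \<and>
       (\<forall>\<^sub>F n in sequentially.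
          complex_of_real (f n) = poly (cpoly P) (of_nat n) / poly (cpoly Q) (of_nat n)))"

lemma rational_with_poles_in_mono:
  "rational_with_poles_in B f \<Longrightarrow> B \<subseteq> B' \<Longrightarrow> rational_with_poles_in B' f"
  unfolding rational_with_poles_in_def by (meson image_mono subsetD)

lemma rational_with_poles_in_of_int: "rational_with_poles_in B (\<lambda>n. of_int c)"
  unfolding rational_with_poles_in_def
  by (intro exI[of _ "[:of_int c:]"] exI[of _ 1]) auto

lemma rational_with_poles_in_diff:
  assumes "rational_with_poles_in B f" "rational_with_poles_in B g"
  shows "rational_with_poles_in B (\<lambda>n. f n - g n)"
proof -
  obtain P Q P' Q' where Q: "Q \<noteq> 0" "\<And>z. poly (cpoly Q) z = 0 \<Longrightarrow> z \<in> of_int ` B"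
    and f: "\<forall>\<^sub>F n in sequentially.
      complex_of_real (f n) = poly (cpoly P) (of_nat n) / poly (cpoly Q) (of_nat n)"
    and Q': "Q' \<noteq> 0" "\<And>z. poly (cpoly Q') z = 0 \<Longrightarrow> z \<in> of_int ` B"
    and g: "\<forall>\<^sub>F n in sequentially.
      complex_of_real (g n) = poly (cpoly P') (of_nat n) / poly (cpoly Q') (of_nat n)"
    using assms unfolding rational_with_poles_in_def by blast
  have "\<forall>\<^sub>F n in sequentially. complex_of_real (f n - g n) =
      poly (cpoly (P * Q' - P' * Q)) (of_nat n) / poly (cpoly (Q * Q')) (of_nat n)"
    using f g eventually_poly_cpoly_nonzero[OF Q(1)] eventually_poly_cpoly_nonzero[OF Q'(1)]
    by eventually_elim (simp add: diff_frac_eq)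
  then show ?thesis
    unfolding rational_with_poles_in_def using Q Q'
    by (intro exI[of _ "P * Q' - P' * Q"] exI[of _ "Q * Q'"]) auto
qed

lemma rational_with_poles_in_add:
  assumes "rational_with_poles_in B f" "rational_with_poles_in B g"
  shows "rational_with_poles_in B (\<lambda>n. f n + g n)"
  using rational_with_poles_in_diff[OF assms(1) rational_with_poles_in_diff[OF
      rational_with_poles_in_of_int[of B 0] assms(2)]] by simp

lemma rational_with_poles_in_sum:
  assumes "\<And>x. x \<in> A \<Longrightarrow> rational_with_poles_in B (f x)"
  shows "rational_with_poles_in B (\<lambda>n. \<Sum>x\<in>A. f x n)"
  using assms
proof (induction A rule: infinite_finite_induct)
  case (insert x A)
  then show ?case by (simp add: rational_with_poles_in_add)
qed (use rational_with_poles_in_of_int[of B 0] in simp_all)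

lemma rational_with_poles_in_mult_of_int:
  assumes "rational_with_poles_in B f"
  shows "rational_with_poles_in B (\<lambda>n. of_int c * f n)"
proof -
  obtain P Q where Q: "Q \<noteq> 0" "\<And>z. poly (cpoly Q) z = 0 \<Longrightarrow> z \<in> of_int ` B"
    and f: "\<forall>\<^sub>F n in sequentially.
      complex_of_real (f n) = poly (cpoly P) (of_nat n) / poly (cpoly Q) (of_nat n)"
    using assms unfolding rational_with_poles_in_def by blast
  have "\<forall>\<^sub>F n in sequentially. complex_of_real (of_int c * f n) =
      poly (cpoly (Polynomial.smult (of_int c) P)) (of_nat n) / poly (cpoly Q) (of_nat n)"
    using f by eventually_elim simp
  then show ?thesis
    unfolding rational_with_poles_in_def using Q
    by (intro exI[of _ "Polynomial.smult (of_int c) P"] exI[of _ Q]) auto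
qed

lemma rational_with_poles_in_divide:
  assumes "rational_with_poles_in B f" "d \<in> B"
  shows "rational_with_poles_in B (\<lambda>n. f n / (real n - of_int d))"
proof -
  obtain P Q where Q: "Q \<noteq> 0" "\<And>z. poly (cpoly Q) z = 0 \<Longrightarrow> z \<in> of_int ` B"
    and f: "\<forall>\<^sub>F n in sequentially.
      complex_of_real (f n) = poly (cpoly P) (of_nat n) / poly (cpoly Q) (of_nat n)"
    using assms unfolding rational_with_poles_in_def by blast
  let ?L = "[:- of_int d, 1:] :: rat poly"
  have "\<forall>\<^sub>F n in sequentially. complex_of_real (f n / (real n - of_int d)) =
      poly (cpoly P) (of_nat n) / poly (cpoly (Q * ?L)) (of_nat n)"
    using f by eventually_elim (simp add: of_rat_minus algebra_simps)
  moreover have "Q * ?L \<noteq> 0"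
    unfolding mult_eq_0_iff using Q(1) by simp
  moreover have "z \<in> of_int ` B" if "poly (cpoly (Q * ?L)) z = 0" for z
    using that Q(2) assms(2) by (auto simp: of_rat_minus)
  ultimately show ?thesis
    unfolding rational_with_poles_in_def by blast
qed

section \<open>Evaluation of rational functions and their poles\<close>

lemma ratfun_eval_eq:
  assumes "Q \<noteq> 0" and "r = Fract P Q"
    and "poly (cpoly Q) z \<noteq> 0" "poly (cpoly (snd (quot_of_fract r))) z \<noteq> 0"
  shows "ratfun_eval r z = poly (cpoly P) z / poly (cpoly Q) z"
proof -
  have "Fract (fst (quot_of_fract r)) (snd (quot_of_fract r)) = Fract P Q"
    using assms(2) by simp
  \<comment> \<open>Two representatives agree up to cross multiplication. Dividing back at
    \<open>z\<close> needs both denominators to be nonzero there.\<close>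
  then have "fst (quot_of_fract r) * Q = P * snd (quot_of_fract r)"
    by (simp only: eq_fract(1)[OF snd_quot_of_fract_nonzero assms(1)])
  then have "poly (cpoly (fst (quot_of_fract r) * Q)) z = poly (cpoly (P * snd (quot_of_fract r))) z"
    by simp
  then show ?thesis
    using assms(3,4) by (simp add: ratfun_eval_def field_simps)
qed

text \<open>After cross multiplication the difference is a polynomial vanishing at infinitely many
  integers. This is the uniqueness behind the definite description in
  \<open>haar_moment_ratfun\<close>.\<close>

lemma ratfun_eval_inject:
  assumes "\<forall>\<^sub>F n in sequentially. ratfun_eval r (of_nat n) = ratfun_eval s (of_nat n)"
  shows "r = s"
proof -
  define P Q P' Q' where "P = fst (quot_of_fract r)" "Q = snd (quot_of_fract r)"
    "P' = fst (quot_of_fract s)" "Q' = snd (quot_of_fract s)"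
  note defs = this
  have Q: "Q \<noteq> 0" "Q' \<noteq> 0" by (simp_all add: defs)
  have zeros: "\<forall>\<^sub>F n in sequentially. poly (cpoly (P * Q' - P' * Q)) (of_nat n) = 0"
    using assms eventually_poly_cpoly_nonzero[OF Q(1)] eventually_poly_cpoly_nonzero[OF Q(2)]
    by eventually_elim (simp add: ratfun_eval_def field_simps flip: defs)
  have "P * Q' - P' * Q = 0"
  proof (rule ccontr)
    assume "P * Q' - P' * Q \<noteq> 0"
    from zeros eventually_poly_cpoly_nonzero[OF this] have "\<forall>\<^sub>F n in sequentially :: nat filter. False"
      by eventually_elim blast
    then show False by simp
  qed
  then have "Fract P Q = Fract P' Q'"
    using Q by (simp add: eq_fract)
  then show ?thesis by (simp add: defs)
qed

text \<open>Away from the roots of its reduced denominator the function is continuous, so a pole is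
  such a root. By coprimality the reduced denominator divides every other denominator, in particular
  the \<open>Q\<close> whose roots lie in \<open>B\<close>.\<close>

lemma poles_of_haar_moment_ratfun:
  assumes "rational_with_poles_in B f"
    and f: "\<forall>\<^sub>F n in sequentially. f n = haar_moment (\<mu> n) a"
    and pole: "is_pole (ratfun_eval (haar_moment_ratfun \<mu> a)) z"
  shows "z \<in> of_int ` B"
proof -
  obtain P Q where Q: "Q \<noteq> 0" "\<And>z. poly (cpoly Q) z = 0 \<Longrightarrow> z \<in> of_int ` B"
    and PQ: "\<forall>\<^sub>F n in sequentially.
      complex_of_real (f n) = poly (cpoly P) (of_nat n) / poly (cpoly Q) (of_nat n)"
    using assms(1) unfolding rational_with_poles_in_def by blast
  define r where "r = Fract P Q"
  let ?P = "fst (quot_of_fract r)" and ?Q = "snd (quot_of_fract r)"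
  have r: "\<forall>\<^sub>F n in sequentially. ratfun_eval r (of_nat n) = complex_of_real (haar_moment (\<mu> n) a)"
    using f PQ eventually_poly_cpoly_nonzero[OF Q(1)]
      eventually_poly_cpoly_nonzero[OF snd_quot_of_fract_nonzero[of r]]
    by eventually_elim (simp add: ratfun_eval_eq[OF Q(1) r_def])
  have "haar_moment_ratfun \<mu> a = r"
    unfolding haar_moment_ratfun_def
  proof (rule the_equality)
    fix s assume "\<forall>\<^sub>F n in sequentially. ratfun_eval s (of_nat n) = complex_of_real (haar_moment (\<mu> n) a)"
    with r show "s = r"
      by (intro ratfun_eval_inject) (auto elim: eventually_elim2)
  qed (rule r)
  have "poly (cpoly ?Q) z = 0"
  proof (rule ccontr)
    assume "poly (cpoly ?Q) z \<noteq> 0"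
    then have "isCont (ratfun_eval r) z"
      unfolding ratfun_eval_def by (intro continuous_intros) auto
    then have "(ratfun_eval r \<longlongrightarrow> ratfun_eval r z) (at z)"
      by (simp add: isCont_def)
    then have "\<not> is_pole (ratfun_eval r) z"
      unfolding is_pole_def using not_tendsto_and_filterlim_at_infinity[OF at_neq_bot] by blast
    then show False
      using pole \<open>haar_moment_ratfun \<mu> a = r\<close> by simp
  qed
  moreover have "?Q dvd Q"
  proof -
    have "Fract ?P ?Q = Fract P Q" by (simp add: r_def)
    then have "?P * Q = P * ?Q"
      by (simp only: eq_fract(1)[OF snd_quot_of_fract_nonzero Q(1)])
    then have "?Q dvd ?P * Q" by simp
    then show ?thesis
      using coprime_quot_of_fract[of r] by (simp add: coprime_dvd_mult_right_iff coprime_commute)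
  qed
  ultimately have "poly (cpoly Q) z = 0"
    by (elim dvdE) simp
  then show ?thesis by (rule Q(2))
qed

section \<open>Integrality of Jucys--Murphy elements\<close>

lemma additive_of_int_mult:
  fixes f :: "'a::ring_1 \<Rightarrow> 'a"
  assumes "Modules.additive f"
  shows "f (of_int c * v) = of_int c * f v"
proof -
  interpret additive f by fact
  have nat: "f (of_nat k * v) = of_nat k * f v" for k v
    by (induction k) (simp_all add: zero add algebra_simps)
  show ?thesis
    by (cases c rule: int_diff_cases) (simp add: diff nat left_diff_distrib)
qed

text \<open>This is the product of the factors \<open>K - c\<close> applied to \<open>v\<close>; a
  list allows repeated roots. Scalars act as multiplication by \<open>of_int\<close>, so additive
  maps commute with them, and the pointwise ring of real functions can serve as the module.\<close>

fun annihilate :: "('a::ring_1 \<Rightarrow> 'a) \<Rightarrow> int list \<Rightarrow> 'a \<Rightarrow> 'a" where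
  "annihilate K [] v = v"
| "annihilate K (c # cs) v = annihilate K cs (K v - of_int c * v)"

lemma annihilate_append: "annihilate K (cs @ ds) v = annihilate K ds (annihilate K cs v)"
  by (induction cs arbitrary: v) simp_all

lemma additive_annihilate: "Modules.additive K \<Longrightarrow> Modules.additive (annihilate K cs)"
proof (induction cs)
  case Nil
  then show ?case by (simp add: Modules.additive_def)
next
  case (Cons c cs)
  then interpret additive "annihilate K cs" by simp
  interpret K: additive K by fact
  show ?case
    by unfold_locales (simp add: add[symmetric] K.add algebra_simps)
qed

text \<open>A map carrying \<open>J\<close> to \<open>K\<close> carries every integer polynomial in
  \<open>J\<close> to the same polynomial in \<open>K\<close>. With \<open>J = K\<close> it says
  that maps commuting with \<open>K\<close> commute with polynomials in \<open>K\<close>.\<close>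

lemma annihilate_intertwine:
  fixes T J K :: "'a::ring_1 \<Rightarrow> 'a"
  assumes "Modules.additive T" and "\<And>v. T (J v) = K (T v)"
  shows "T (annihilate J cs v) = annihilate K cs (T v)"
proof -
  interpret additive T by fact
  show ?thesis
    by (induction cs arbitrary: v) (simp_all add: assms(2) diff additive_of_int_mult[OF assms(1)])
qed

text \<open>\<open>J\<close>, \<open>K\<close> and \<open>s\<close> satisfy the relations of consecutive Jucys--Murphy elements and the
  transposition linking them. Put \<open>D = K - J\<close>. Since \<open>D s - 1\<close> intertwines \<open>J\<close> and \<open>K\<close>, a
  polynomial \<open>q\<close> with \<open>q(J) = 0\<close> has \<open>q(K) (D\<^sup>2 - 1) = 0\<close>, so \<open>(K - c)\<^sup>2 - 1\<close> may be replaced by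
  \<open>(K - c)\<^sup>2 - D\<^sup>2 = (2 K - J - c) (J - c)\<close> behind \<open>q(K)\<close>.\<close>

lemma annihilate_jucys_murphy_step:
  fixes J K s :: "'a::ring_1 \<Rightarrow> 'a"
  assumes J: "Modules.additive J" and K: "Modules.additive K" and s: "Modules.additive s"
    and comm: "\<And>v. J (K v) = K (J v)"
    and inv: "\<And>v. s (s v) = v"
    and rel: "\<And>v. s (J v) = K (s v) - v"
    and ann: "\<And>v. annihilate J cs v = 0"
  shows "annihilate K (cs @ concat (map (\<lambda>c. [c + 1, c - 1]) cs)) v = 0"
proof -
  interpret J: additive J by fact
  interpret K: additive K by fact
  interpret s: additive s by fact
  define A where "A = annihilate K cs"
  interpret A: additive A unfolding A_def by (rule additive_annihilate[OF K])
  define D where "D v = K v - J v" for v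
  interpret D: additive D
    by unfold_locales (simp add: D_def K.add J.add)
  define t where "t v = D (s v) - v" for v
  have t: "Modules.additive t"
    by unfold_locales (simp add: t_def s.add D.add)
  have DJ: "D (J v) = J (D v)" and DK: "D (K v) = K (D v)" for v
    by (simp_all add: D_def K.diff J.diff comm)
  \<comment> \<open>Expanding with \<open>rel\<close> gives \<open>K (D (s v)) - D v - J v\<close>,
    and \<open>D v + J v = K v\<close>.\<close>
  have tJ: "t (J v) = K (t v)" for v
    by (simp add: t_def rel D.diff DK K.diff) (simp add: D_def)
  have At: "A (t v) = 0" for v
    using annihilate_intertwine[of t J K cs v, OF t tJ] by (simp add: ann A_def Modules.additive.zero[OF t])
  have ADs: "A (D (s v)) = A v" for v
    using At[of v] by (simp add: t_def A.diff)
  have AD: "A (D v) = A (s v)" for v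
    using ADs[of "s v"] by (simp add: inv)
  have DA: "D (A v) = A (D v)" for v
    unfolding A_def by (rule annihilate_intertwine) (simp_all add: D.additive_axioms DK)
  \<comment> \<open>As \<open>D\<close> commutes with \<open>A\<close>, the chain is
    \<open>A D D = D A D = D A s = A D s = A\<close>.\<close>
  have ADD: "A (D (D v)) = A v" for v
    using AD[of v] ADs[of v] DA[of "D v"] DA[of "s v"] by simp
  have KA: "annihilate K ds (A v) = A (annihilate K ds v)" for ds v
    unfolding A_def
    by (rule annihilate_intertwine[symmetric, OF additive_annihilate[OF K]])
      (rule annihilate_intertwine[of K K K, symmetric], rule K, rule refl)
  have int: "K (of_int c * v) = of_int c * K v" "J (of_int c * v) = of_int c * J v" for c v
    using additive_of_int_mult[OF K] additive_of_int_mult[OF J] by auto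
  have vanish: "A (annihilate K (concat (map (\<lambda>c. [c + 1, c - 1]) ds)) v) = 0"
    if "annihilate J ds v = 0" for ds v
    using that
  proof (induction ds arbitrary: v)
    case Nil
    then show ?case by (simp add: A.zero)
  next
    case (Cons c ds)
    let ?B = "annihilate K (concat (map (\<lambda>c. [c + 1, c - 1]) ds))"
    let ?g = "\<lambda>v. J v - of_int c * v"
    let ?h = "\<lambda>v. K v + D v - of_int c * v"
    have h: "Modules.additive ?h"
      by unfold_locales (simp add: K.add D.add algebra_simps)
    have hJ: "?h (J w) = J (?h w)" for w
      by (simp add: comm DJ J.diff J.add int)
    \<comment> \<open>The cofactor \<open>?h\<close> is \<open>2 K - J - c\<close>. It commutes with
      \<open>J\<close>, so the remaining factors \<open>ds\<close> still kill the vector and the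
      induction hypothesis applies to it.\<close>
    have "annihilate J ds (?h (?g v)) = ?h (annihilate J ds (?g v))"
      by (rule annihilate_intertwine[of ?h J J, OF h hJ, symmetric])
    also have "\<dots> = 0"
      using Cons.prems by (simp add: Modules.additive.zero[OF h] K.zero D.zero)
    finally have IH: "A (?B (?h (?g v))) = 0"
      by (rule Cons.IH)
    let ?w = "K v - of_int (c + 1) * v"
    let ?x = "K ?w - of_int (c - 1) * ?w"
    have "?x = ?h (?g v) + (D (D v) - v)"
      by (simp add: D_def K.diff J.diff K.add comm int algebra_simps)
    then have "A ?x = A (?h (?g v))"
      by (simp add: A.add A.diff ADD)
    then have "A (?B ?x) = A (?B (?h (?g v)))"
      by (simp only: KA[symmetric])
    then show ?case using IH by simp
  qed
  show ?thesis
    using vanish[OF ann] by (simp add: annihilate_append KA flip: A_def)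
qed

section \<open>Transpositions acting on matchings by conjugation\<close>

definition relabel :: "'a \<Rightarrow> 'a \<Rightarrow> ('a \<Rightarrow> 'a) \<Rightarrow> 'a \<Rightarrow> 'a" where
  "relabel x y \<sigma> = Transposition.transpose x y \<circ> \<sigma> \<circ> Transposition.transpose x y"

lemma relabel_relabel [simp]: "relabel x y (relabel x y \<sigma>) = \<sigma>"
  by (simp add: relabel_def fun_eq_iff)

text \<open>Conjugating the transposition \<open>(c d)\<close> by \<open>t\<close> gives the
  transposition \<open>(t c, t d)\<close>.\<close>

lemma relabel_braid:
  fixes a b :: 'a
  defines "t \<equiv> Transposition.transpose a b"
  shows "relabel a b (relabel c d \<sigma>) = relabel (t c) (t d) (relabel a b \<sigma>)"
proof -
  have "t (Transposition.transpose c d z) = Transposition.transpose (t c) (t d) (t z)" for z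
    unfolding t_def by (auto simp: Transposition.transpose_def)
  moreover have "Transposition.transpose c d (t z) = t (Transposition.transpose (t c) (t d) z)" for z
    unfolding t_def by (auto simp: Transposition.transpose_def)
  ultimately show ?thesis
    by (simp add: relabel_def fun_eq_iff flip: t_def)
qed

text \<open>The Jucys--Murphy element of the symmetric group on \<open>S\<close> with
  \<open>x\<close> as last letter; its predecessor in the chain belongs to \<open>S - {x}\<close>
  and another point \<open>y\<close>. It acts on functions of arbitrary maps, and the restriction to
  matchings is made only where needed.\<close>

definition jucys_murphy :: "'a set \<Rightarrow> 'a \<Rightarrow> (('a \<Rightarrow> 'a) \<Rightarrow> real) \<Rightarrow> ('a \<Rightarrow> 'a) \<Rightarrow> real" where
  "jucys_murphy S x f \<sigma> = (\<Sum>m\<in>S - {x}. f (relabel x m \<sigma>))"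

lemma additive_jucys_murphy: "Modules.additive (jucys_murphy S x)"
  by unfold_locales (simp add: fun_eq_iff jucys_murphy_def sum.distrib)

text \<open>Each transposition \<open>(y l)\<close> of the smaller sum fixes \<open>x\<close>, so
  conjugation by it merely permutes the transpositions \<open>(x m)\<close> of the larger
  one.\<close>

lemma jucys_murphy_commute:
  assumes "y \<in> S" "x \<noteq> y"
  shows "jucys_murphy (S - {x}) y (jucys_murphy S x f) = jucys_murphy S x (jucys_murphy (S - {x}) y f)"
proof
  fix \<sigma>
  have "(\<Sum>m\<in>S - {x}. f (relabel x m (relabel y l \<sigma>))) = (\<Sum>m\<in>S - {x}. f (relabel y l (relabel x m \<sigma>)))"
    if l: "l \<in> S - {x} - {y}" for l
  proof -
    have x_fixed: "Transposition.transpose y l x = x"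
      using l assms by (intro transpose_apply_other) auto
    show ?thesis
    proof (rule sum.reindex_bij_witness[of _ "Transposition.transpose y l" "Transposition.transpose y l"])
      fix m assume "m \<in> S - {x}"
      then show "Transposition.transpose y l m \<in> S - {x}"
        using l assms by (auto simp: Transposition.transpose_def)
      show "f (relabel y l (relabel x (Transposition.transpose y l m) \<sigma>)) = f (relabel x m (relabel y l \<sigma>))"
        using x_fixed by (simp add: relabel_braid[of y l])
    qed (use l assms in \<open>auto simp: Transposition.transpose_def\<close>)
  qed
  then show "jucys_murphy (S - {x}) y (jucys_murphy S x f) \<sigma> =
    jucys_murphy S x (jucys_murphy (S - {x}) y f) \<sigma>"
    unfolding jucys_murphy_def by (subst (2) sum.swap) simp
qed

text \<open>Conjugation by \<open>(x y)\<close> turns \<open>(y m)\<close> into \<open>(x m)\<close>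
  for all other \<open>m\<close>. The extra term \<open>m = y\<close> of the larger sum undoes the
  relabelling and contributes \<open>f \<sigma>\<close>. This is the relation \<open>rel\<close> of
  \<open>annihilate_jucys_murphy_step\<close>.\<close>

lemma jucys_murphy_relabel:
  assumes "finite S" "y \<in> S" "x \<noteq> y"
  shows "jucys_murphy (S - {x}) y f (relabel x y \<sigma>) =
    jucys_murphy S x (\<lambda>\<tau>. f (relabel x y \<tau>)) \<sigma> - f \<sigma>"
proof -
  have "jucys_murphy S x (\<lambda>\<tau>. f (relabel x y \<tau>)) \<sigma> =
      f \<sigma> + (\<Sum>m\<in>S - {x} - {y}. f (relabel x y (relabel x m \<sigma>)))"
    unfolding jucys_murphy_def using assms by (subst sum.remove[of _ y]) auto
  also have "(\<Sum>m\<in>S - {x} - {y}. f (relabel x y (relabel x m \<sigma>))) =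
      (\<Sum>m\<in>S - {x} - {y}. f (relabel y m (relabel x y \<sigma>)))"
    by (intro sum.cong refl) (auto simp: relabel_braid[of x y])
  finally show ?thesis by (simp add: jucys_murphy_def)
qed

text \<open>Induction along the chain of Jucys--Murphy elements: adding a point adjoins to every
  root \<open>c\<close> its neighbours \<open>c + 1\<close> and \<open>c - 1\<close>, so the range
  of roots grows by one on either side. For a single point the element is an empty sum, with root
  \<open>0\<close>.\<close>

lemma jucys_murphy_integral_spectrum:
  assumes "finite S" "x \<in> S"
  shows "\<exists>cs. set cs \<subseteq> {- int (card S - 1)..int (card S - 1)} \<and> (\<forall>f. annihilate (jucys_murphy S x) cs f = 0)"
  using assms
proof (induction "card S" arbitrary: S x)
  case 0
  then show ?case by simp
next
  case (Suc n)
  show ?case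
  proof (cases "S = {x}")
    case True
    then show ?thesis
      by (intro exI[of _ "[0]"]) (auto simp: jucys_murphy_def fun_eq_iff)
  next
    case False
    then obtain y where y: "y \<in> S" "x \<noteq> y"
      using Suc.prems by blast
    have n: "n = card (S - {x})"
      using Suc.hyps(2) Suc.prems by simp
    obtain cs where cs: "set cs \<subseteq> {- int (n - 1)..int (n - 1)}"
      and ann: "\<And>f. annihilate (jucys_murphy (S - {x}) y) cs f = 0"
      using Suc.hyps(1)[OF n, of y] y Suc.prems unfolding n by auto
    have "annihilate (jucys_murphy S x) (cs @ concat (map (\<lambda>c. [c + 1, c - 1]) cs)) f = 0" for f
    proof (rule annihilate_jucys_murphy_step[OF additive_jucys_murphy additive_jucys_murphy _ _ _ _ ann])
      show "Modules.additive (\<lambda>f \<tau>. f (relabel x y \<tau>) :: real)"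
        by unfold_locales (simp add: fun_eq_iff)
    qed (use y Suc.prems in \<open>auto simp: jucys_murphy_commute jucys_murphy_relabel fun_eq_iff\<close>)
    moreover have "set (cs @ concat (map (\<lambda>c. [c + 1, c - 1]) cs)) \<subseteq> {- int n..int n}"
    proof -
      have "n \<noteq> 0" using n y Suc.prems(1) by (metis DiffI card_0_eq empty_iff finite_Diff singletonD)
      then have "- int n + 1 \<le> c" "c \<le> int n - 1" if "c \<in> set cs" for c
        using subsetD[OF cs that] by (simp_all add: of_nat_diff)
      note bound = this
      show ?thesis
      proof
        fix d assume "d \<in> set (cs @ concat (map (\<lambda>c. [c + 1, c - 1]) cs))"
        then obtain c where "c \<in> set cs" "d = c \<or> d = c + 1 \<or> d = c - 1"
          by auto
        then show "d \<in> {- int n..int n}"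
          using bound[of c] by auto
      qed
    qed
    ultimately show ?thesis
      using Suc.hyps(2) by (metis diff_Suc_1)
  qed
qed

section \<open>Perfect matchings\<close>

text \<open>A perfect matching is encoded as a fixed-point-free involution of \<open>S\<close>,
  extended by the identity; \<open>\<sigma> s\<close> is the partner of \<open>s\<close>. As a
  permutation it can be conjugated by transpositions.\<close>

definition matchings :: "'a set \<Rightarrow> ('a \<Rightarrow> 'a) set" where
  "matchings S = {\<sigma>. \<sigma> permutes S \<and> (\<forall>s\<in>S. \<sigma> s \<noteq> s \<and> \<sigma> (\<sigma> s) = s)}"

lemma finite_matchings: "finite S \<Longrightarrow> finite (matchings S)"
  by (rule finite_subset[OF _ finite_permutations]) (auto simp: matchings_def)

lemma matchingsD:
  assumes "\<sigma> \<in> matchings S"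
  shows "\<sigma> (\<sigma> z) = z" "\<sigma> z \<in> S \<longleftrightarrow> z \<in> S" "z \<in> S \<Longrightarrow> \<sigma> z \<noteq> z" "z \<notin> S \<Longrightarrow> \<sigma> z = z"
proof -
  have p: "\<sigma> permutes S" using assms by (simp add: matchings_def)
  show "\<sigma> z \<in> S \<longleftrightarrow> z \<in> S" "z \<notin> S \<Longrightarrow> \<sigma> z = z"
    using permutes_in_image[OF p] permutes_not_in[OF p] by auto
  then show "\<sigma> (\<sigma> z) = z" "z \<in> S \<Longrightarrow> \<sigma> z \<noteq> z"
    using assms by (cases "z \<in> S"; auto simp: matchings_def)+
qed

lemma relabel_matchings:
  assumes "\<sigma> \<in> matchings S" "x \<in> S" "m \<in> S"
  shows "relabel x m \<sigma> \<in> matchings S"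
proof -
  have "relabel x m \<sigma> permutes S"
    unfolding relabel_def using assms
    by (intro permutes_compose permutes_swap_id) (auto simp: matchings_def)
  moreover have "relabel x m \<sigma> s \<noteq> s" if "s \<in> S" for s
  proof
    assume "relabel x m \<sigma> s = s"
    then have "Transposition.transpose x m (relabel x m \<sigma> s) = Transposition.transpose x m s"
      by simp
    then have "\<sigma> (Transposition.transpose x m s) = Transposition.transpose x m s"
      by (simp add: relabel_def)
    moreover have "Transposition.transpose x m s \<in> S"
      using assms that by (auto simp: Transposition.transpose_def)
    ultimately show False
      using matchingsD(3)[OF assms(1)] by blast
  qed
  ultimately show ?thesis
    by (simp add: matchings_def) (simp add: relabel_def matchingsD[OF assms(1)])
qed

text \<open>Exchanging the two ends of one pair changes nothing. Hence the Jucys--Murphy element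
  contains the identity once when acting on functions of matchings.\<close>

lemma relabel_partner:
  assumes "\<sigma> \<in> matchings S"
  shows "relabel x (\<sigma> x) \<sigma> = \<sigma>"
proof
  fix z
  note M = matchingsD(1)[OF assms]
  consider "z = x" | "z = \<sigma> x" | "z \<noteq> x" "z \<noteq> \<sigma> x" "\<sigma> z \<noteq> x" "\<sigma> z \<noteq> \<sigma> x"
    by (metis M)
  then show "relabel x (\<sigma> x) \<sigma> z = \<sigma> z"
    by cases (simp_all add: M relabel_def Transposition.transpose_def)
qed

text \<open>The matchings that agree with \<open>\<sigma>\<close> off the four points \<open>x\<close>, \<open>\<sigma> x\<close>, \<open>m\<close>, \<open>\<sigma> m\<close> are
  \<open>\<sigma>\<close>, \<open>relabel x m \<sigma>\<close> and \<open>relabel x (\<sigma> m) \<sigma>\<close>. The estimate says that the squares of the sums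
  of \<open>f\<close> over all such triples add up to something nonnegative.\<close>

lemma jucys_murphy_lower_bound:
  assumes "finite S" "x \<in> S" "card S = 2 * k"
  shows "(2 - real k) * (\<Sum>\<sigma>\<in>matchings S. (f \<sigma>)\<^sup>2) \<le> (\<Sum>\<sigma>\<in>matchings S. f \<sigma> * jucys_murphy S x f \<sigma>)"
proof -
  let ?M = "matchings S"
  define P where "P = (SIGMA \<sigma>:?M. S - {x, \<sigma> x})"
  define f1 where "f1 p = f (fst p)" for p :: "('a \<Rightarrow> 'a) \<times> 'a"
  \<comment> \<open>Both are involutions of \<open>P\<close>: \<open>\<alpha>\<close> passes to the
    relabelled matching, \<open>\<beta>\<close> replaces \<open>m\<close> by its partner. They
    satisfy the braid relation, and \<open>f1\<close> does not change under \<open>\<beta>\<close>;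
    therefore the sum \<open>g\<close> over the triple is invariant under both.\<close>
  define \<alpha> where "\<alpha> p = (relabel x (snd p) (fst p), snd p)" for p :: "('a \<Rightarrow> 'a) \<times> 'a"
  define \<beta> where "\<beta> p = (fst p, fst p (snd p))" for p :: "('a \<Rightarrow> 'a) \<times> 'a"
  define g where "g p = f1 p + f1 (\<alpha> p) + f1 (\<alpha> (\<beta> p))" for p
  have finP: "finite P"
    unfolding P_def using assms by (auto simp: finite_matchings)
  have quad: "\<alpha> p \<in> P \<and> \<alpha> (\<alpha> p) = p \<and> \<beta> p \<in> P \<and> \<beta> (\<beta> p) = p \<and>
      \<alpha> (\<beta> (\<alpha> p)) = \<beta> (\<alpha> (\<beta> p))" if pP: "p \<in> P" for p
  proof -
    obtain \<sigma> m where p: "p = (\<sigma>, m)" and \<sigma>: "\<sigma> \<in> ?M" and m: "m \<in> S" "m \<noteq> x" "m \<noteq> \<sigma> x"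
      using pP by (cases p) (auto simp: P_def)
    note M = matchingsD[OF \<sigma>]
    have inj: "\<sigma> u = \<sigma> v \<longleftrightarrow> u = v" for u v
    proof
      assume "\<sigma> u = \<sigma> v"
      then have "\<sigma> (\<sigma> u) = \<sigma> (\<sigma> v)" by (rule arg_cong)
      then show "u = v" by (simp only: M(1))
    qed simp
    have ne: "\<sigma> m \<noteq> m" "\<sigma> x \<noteq> x" "\<sigma> m \<noteq> \<sigma> x"
      using M(3) m assms(2) by (simp_all add: inj)
    have "\<sigma> m \<noteq> x"
      using m(3) M(1)[of m] by (intro notI) simp
    note ne = this ne
    have x: "relabel x m \<sigma> x = \<sigma> m" and m': "relabel x m \<sigma> m = \<sigma> x"
      using ne m by (simp_all add: relabel_def Transposition.transpose_def)
    have "\<alpha> p \<in> P"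
      using ne m \<sigma> assms(2) by (simp add: \<alpha>_def P_def p x relabel_matchings)
    moreover have "\<beta> p \<in> P"
      using ne m \<sigma> by (simp add: \<beta>_def P_def p M(2))
    moreover have "relabel x (\<sigma> x) (relabel x m \<sigma>) = relabel x (\<sigma> m) \<sigma>"
    proof
      fix z
      consider "z = x" | "z = m" | "z = \<sigma> x" | "z = \<sigma> m" | "z \<notin> {x, m, \<sigma> x, \<sigma> m}" by blast
      then show "relabel x (\<sigma> x) (relabel x m \<sigma>) z = relabel x (\<sigma> m) \<sigma> z"
      proof cases
        case 5
        then have "\<sigma> z \<notin> {x, m, \<sigma> x, \<sigma> m}"
          using M(1)[of z] M(1)[of x] M(1)[of m] by auto
        then show ?thesis
          using 5 by (simp add: relabel_def Transposition.transpose_def)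
      qed (use ne m M(1) in \<open>simp_all add: relabel_def Transposition.transpose_def inj\<close>)
    qed
    moreover have "relabel x (\<sigma> m) \<sigma> (\<sigma> m) = \<sigma> x"
      using ne m M(1) by (simp add: relabel_def Transposition.transpose_def)
    ultimately show ?thesis
      by (simp add: \<alpha>_def \<beta>_def p M(1) m')
  qed
  have \<alpha>: "(\<Sum>p\<in>P. h (\<alpha> p)) = (\<Sum>p\<in>P. h p)" for h :: "_ \<Rightarrow> real"
    by (rule sum.reindex_bij_witness[of _ \<alpha> \<alpha>]) (use quad in auto)
  have \<beta>: "(\<Sum>p\<in>P. h (\<beta> p)) = (\<Sum>p\<in>P. h p)" for h :: "_ \<Rightarrow> real"
    by (rule sum.reindex_bij_witness[of _ \<beta> \<beta>]) (use quad in auto)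
  have g\<alpha>: "g (\<alpha> p) = g p" and g\<beta>: "g (\<beta> p) = g p" if "p \<in> P" for p
  proof -
    have "f1 (\<beta> q) = f1 q" for q by (simp add: f1_def \<beta>_def)
    then show "g (\<alpha> p) = g p" "g (\<beta> p) = g p"
      using quad[OF that] by (simp_all add: g_def)
  qed
  have "(\<Sum>p\<in>P. g p * f1 (\<alpha> p)) = (\<Sum>p\<in>P. g (\<alpha> p) * f1 (\<alpha> p))"
    by (intro sum.cong refl) (simp add: g\<alpha>)
  also have "\<dots> = (\<Sum>p\<in>P. g p * f1 p)"
    by (rule \<alpha>)
  finally have 1: "(\<Sum>p\<in>P. g p * f1 (\<alpha> p)) = (\<Sum>p\<in>P. g p * f1 p)" .
  have "(\<Sum>p\<in>P. g p * f1 (\<alpha> (\<beta> p))) = (\<Sum>p\<in>P. g (\<beta> p) * f1 (\<alpha> (\<beta> p)))"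
    by (intro sum.cong refl) (simp add: g\<beta>)
  also have "\<dots> = (\<Sum>p\<in>P. g p * f1 (\<alpha> p))"
    by (rule \<beta>[of "\<lambda>p. g p * f1 (\<alpha> p)"])
  finally have 2: "(\<Sum>p\<in>P. g p * f1 (\<alpha> (\<beta> p))) = (\<Sum>p\<in>P. g p * f1 p)"
    using 1 by simp
  \<comment> \<open>One factor \<open>g\<close> is expanded into its three summands. By the
    invariance of \<open>g\<close> they all contribute equally.\<close>
  have "0 \<le> (\<Sum>p\<in>P. (g p)\<^sup>2)"
    by (simp add: sum_nonneg)
  also have "\<dots> = (\<Sum>p\<in>P. g p * f1 p) + (\<Sum>p\<in>P. g p * f1 (\<alpha> p)) + (\<Sum>p\<in>P. g p * f1 (\<alpha> (\<beta> p)))"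
    by (simp add: g_def power2_eq_square algebra_simps flip: sum.distrib)
  also have "\<dots> = 3 * (\<Sum>p\<in>P. g p * f1 p)"
    using 1 2 by simp
  finally have "0 \<le> (\<Sum>p\<in>P. g p * f1 p)"
    by simp
  also have "\<dots> = (\<Sum>\<sigma>\<in>?M. \<Sum>m\<in>S - {x, \<sigma> x}. g (\<sigma>, m) * f \<sigma>)"
    unfolding P_def using assms by (subst sum.Sigma) (auto simp: f1_def finite_matchings intro!: sum.cong)
  also have "\<dots> = (\<Sum>\<sigma>\<in>?M. 2 * (f \<sigma> * jucys_murphy S x f \<sigma>) + (2 * real k - 4) * (f \<sigma>)\<^sup>2)"
  proof (intro sum.cong refl)
    fix \<sigma> assume \<sigma>: "\<sigma> \<in> ?M"
    note M = matchingsD[OF \<sigma>]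
    let ?R = "S - {x, \<sigma> x}"
    have "card ?R = 2 * k - 2"
      using assms M(2)[of x] M(3)[of x] by (subst card_Diff_subset) auto
    moreover have "k \<ge> 1" using assms by (cases k) auto
    ultimately have card: "real (card ?R) = 2 * real k - 2" by simp
    have R: "\<sigma> m \<in> ?R" if "m \<in> ?R" for m
      using that M(2)[of m] M(1)[of m] M(1)[of x] by auto
    have 1: "(\<Sum>m\<in>?R. f (relabel x (\<sigma> m) \<sigma>)) = (\<Sum>m\<in>?R. f (relabel x m \<sigma>))"
      by (rule sum.reindex_bij_witness[of _ \<sigma> \<sigma>]) (use R in \<open>simp_all add: M(1)\<close>)
    \<comment> \<open>The term for the partner of \<open>x\<close> equals \<open>f \<sigma>\<close>;
      the others are indexed by \<open>?R\<close>, where \<open>m\<close> and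
      \<open>\<sigma> m\<close> run through the same points.\<close>
    have "jucys_murphy S x f \<sigma> = f (relabel x (\<sigma> x) \<sigma>) + (\<Sum>m\<in>S - {x} - {\<sigma> x}. f (relabel x m \<sigma>))"
      unfolding jucys_murphy_def using assms M(2)[of x] M(3)[of x] by (intro sum.remove) auto
    also have "S - {x} - {\<sigma> x} = ?R" by auto
    finally have 2: "(\<Sum>m\<in>?R. f (relabel x m \<sigma>)) = jucys_murphy S x f \<sigma> - f \<sigma>"
      by (simp add: relabel_partner[OF \<sigma>])
    have "(\<Sum>m\<in>?R. g (\<sigma>, m) * f \<sigma>) = (\<Sum>m\<in>?R. f \<sigma> + f (relabel x m \<sigma>) + f (relabel x (\<sigma> m) \<sigma>)) * f \<sigma>"
      by (simp add: g_def f1_def \<alpha>_def \<beta>_def sum_distrib_right)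
    also have "\<dots> = ((2 * real k - 2) * f \<sigma> + 2 * (jucys_murphy S x f \<sigma> - f \<sigma>)) * f \<sigma>"
      by (simp add: sum.distrib 1 2 card)
    finally show "(\<Sum>m\<in>?R. g (\<sigma>, m) * f \<sigma>) =
        2 * (f \<sigma> * jucys_murphy S x f \<sigma>) + (2 * real k - 4) * (f \<sigma>)\<^sup>2"
      by (simp add: power2_eq_square algebra_simps)
  qed
  also have "\<dots> = 2 * ((\<Sum>\<sigma>\<in>?M. f \<sigma> * jucys_murphy S x f \<sigma>) - (2 - real k) * (\<Sum>\<sigma>\<in>?M. (f \<sigma>)\<^sup>2))"
    by (simp add: sum.distrib sum_distrib_left algebra_simps sum_subtractf)
  finally show ?thesis by simp
qed

section \<open>Discarding small roots and inverting the Jucys--Murphy element\<close>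

lemma of_int_fun_apply: "(of_int c :: 'a \<Rightarrow> 'b::ring_1) x = of_int c"
proof -
  have "(of_nat n :: 'a \<Rightarrow> 'b) x = of_nat n" for n
    by (induction n) simp_all
  then show ?thesis
    by (cases c rule: int_diff_cases) (simp add: fun_diff_def)
qed

text \<open>For an eigenfunction the quadratic form equals \<open>c\<close> times the sum of
  squares, which contradicts \<open>jucys_murphy_lower_bound\<close> unless that sum is
  zero.\<close>

lemma jucys_murphy_injective_below:
  assumes "finite S" "x \<in> S" "card S = 2 * k" "c < 2 - int k"
    and eq: "\<And>\<sigma>. \<sigma> \<in> matchings S \<Longrightarrow> jucys_murphy S x f \<sigma> = of_int c * f \<sigma>"
    and "\<sigma> \<in> matchings S"
  shows "f \<sigma> = 0"
proof -
  let ?q = "\<Sum>\<sigma>\<in>matchings S. (f \<sigma>)\<^sup>2"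
  have "(2 - real k) * ?q \<le> (\<Sum>\<sigma>\<in>matchings S. f \<sigma> * jucys_murphy S x f \<sigma>)"
    by (rule jucys_murphy_lower_bound[OF assms(1-3)])
  also have "\<dots> = of_int c * ?q"
    by (simp add: eq power2_eq_square sum_distrib_left algebra_simps)
  finally have "(2 - real k - of_int c) * ?q \<le> 0"
    by (simp add: algebra_simps)
  moreover have "2 - real k - of_int c > 0"
    using assms(4) by linarith
  ultimately have "?q \<le> 0"
    by (simp add: mult_le_0_iff)
  then have "?q = 0"
    by (meson order_antisym sum_nonneg zero_le_power2)
  then show ?thesis
    using assms(6) by (simp add: sum_nonneg_eq_0_iff finite_matchings[OF assms(1)])
qed

text \<open>A factor \<open>J - c\<close> with \<open>c < 2 - k\<close> is injective on functions of
  matchings, so it can be cancelled from the product that kills \<open>f\<close>.\<close>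

lemma annihilate_jucys_murphy_filter:
  assumes "finite S" "x \<in> S" "card S = 2 * k"
    and "\<And>\<sigma>. \<sigma> \<in> matchings S \<Longrightarrow> annihilate (jucys_murphy S x) cs f \<sigma> = 0"
    and "\<sigma> \<in> matchings S"
  shows "annihilate (jucys_murphy S x) (filter (\<lambda>c. 2 - int k \<le> c) cs) f \<sigma> = 0"
  using assms(4,5)
proof (induction cs arbitrary: f \<sigma>)
  case Nil
  then show ?case by simp
next
  case (Cons c cs)
  let ?K = "jucys_murphy S x"
  let ?A = "annihilate ?K (filter (\<lambda>c. 2 - int k \<le> c) cs)"
  have IH: "?A (?K f - of_int c * f) \<tau> = 0" if "\<tau> \<in> matchings S" for \<tau>
    by (rule Cons.IH[OF Cons.prems(1)[unfolded annihilate.simps] that])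
  show ?case
  proof (cases "2 - int k \<le> c")
    case True
    then show ?thesis using IH[OF Cons.prems(2)] by simp
  next
    case False
    interpret K: Modules.additive ?K by (rule additive_jucys_murphy)
    let ?T = "\<lambda>v. ?K v - of_int c * v"
    \<comment> \<open>Polynomials in the same operator commute, so the factor to be cancelled can be
      applied last.\<close>
    have "?A (?T f) = ?T (?A f)"
    proof (rule annihilate_intertwine[of ?T ?K ?K, symmetric])
      show "Modules.additive ?T"
        by unfold_locales (simp add: K.add algebra_simps)
      show "?T (?K v) = ?K (?T v)" for v
        by (simp add: K.diff additive_of_int_mult additive_jucys_murphy)
    qed
    then have "?K (?A f) \<tau> = of_int c * ?A f \<tau>" if "\<tau> \<in> matchings S" for \<tau>
      using IH[OF that] by (simp add: of_int_fun_apply)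
    then have "?A f \<sigma> = 0"
      using False Cons.prems(2)
      by (intro jucys_murphy_injective_below[where f = "?A f" and c = c, OF assms(1-3)]) auto
    then show ?thesis using False by simp
  qed
qed

text \<open>An explicit solution \<open>w\<close> of \<open>(K - y) w = f\<close> when the factors
  in the list kill \<open>f\<close>: if \<open>r\<close> solves
  \<open>(K - y) r = (K - c) f\<close>, then \<open>w = (f - r) / (c - y)\<close>. The only
  divisions are by \<open>c - y\<close>, which makes the poles visible. For the empty list
  \<open>f\<close> itself is zero.\<close>

fun resolvent :: "(('a \<Rightarrow> real) \<Rightarrow> 'a \<Rightarrow> real) \<Rightarrow> real \<Rightarrow> int list \<Rightarrow> ('a \<Rightarrow> real) \<Rightarrow> 'a \<Rightarrow> real" where
  "resolvent K y [] f = (\<lambda>\<sigma>. 0)"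
| "resolvent K y (c # cs) f =
     (\<lambda>\<sigma>. (f \<sigma> - resolvent K y cs (K f - of_int c * f) \<sigma>) / (of_int c - y))"

lemma resolvent_jucys_murphy:
  assumes "\<And>c. c \<in> set cs \<Longrightarrow> of_int c \<noteq> y"
    and "\<And>\<sigma>. \<sigma> \<in> M \<Longrightarrow> annihilate (jucys_murphy S x) cs f \<sigma> = 0"
    and "\<sigma> \<in> M"
  shows "jucys_murphy S x (resolvent (jucys_murphy S x) y cs f) \<sigma>
    - y * resolvent (jucys_murphy S x) y cs f \<sigma> = f \<sigma>"
  using assms
proof (induction cs arbitrary: f)
  case Nil
  then show ?case by (simp add: jucys_murphy_def)
next
  case (Cons c cs)
  let ?K = "jucys_murphy S x"
  let ?r = "resolvent ?K y cs (?K f - of_int c * f)"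
  have IH: "?K ?r \<sigma> - y * ?r \<sigma> = ?K f \<sigma> - of_int c * f \<sigma>"
  proof -
    have "?K ?r \<sigma> - y * ?r \<sigma> = (?K f - of_int c * f) \<sigma>"
      by (rule Cons.IH[OF _ Cons.prems(2)[unfolded annihilate.simps] Cons.prems(3)])
        (simp add: Cons.prems(1))
    then show ?thesis by (simp add: of_int_fun_apply)
  qed
  have K: "?K (\<lambda>\<sigma>. (f \<sigma> - ?r \<sigma>) / (of_int c - y)) \<sigma> = (?K f \<sigma> - ?K ?r \<sigma>) / (of_int c - y)"
    by (simp add: jucys_murphy_def sum_subtractf flip: sum_divide_distrib)
  have "of_int c - y \<noteq> 0"
    using Cons.prems(1)[of c] by simp
  moreover have "?K f \<sigma> - ?K ?r \<sigma> - y * (f \<sigma> - ?r \<sigma>) = (of_int c - y) * f \<sigma>"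
    using IH by (simp add: algebra_simps)
  moreover have "?K (\<lambda>\<sigma>. (f \<sigma> - ?r \<sigma>) / (of_int c - y)) \<sigma> - y * ((f \<sigma> - ?r \<sigma>) / (of_int c - y))
      = (?K f \<sigma> - ?K ?r \<sigma> - y * (f \<sigma> - ?r \<sigma>)) / (of_int c - y)"
    unfolding K diff_divide_distrib[of "?K f \<sigma> - ?K ?r \<sigma>" "y * (f \<sigma> - ?r \<sigma>)"]
    by (simp only: times_divide_eq_right)
  ultimately show ?case
    by simp
qed

section \<open>Moments of the Haar measure\<close>

lemma orthogonal_groupD:
  assumes "u \<in> orthogonal_group n"
  shows "u \<in> carrier_mat n n"
    and "b < n \<Longrightarrow> b' < n \<Longrightarrow> (\<Sum>l<n. u $$ (l, b) * u $$ (l, b')) = (if b = b' then 1 else 0)"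
    and "a < n \<Longrightarrow> b < n \<Longrightarrow> \<bar>u $$ (a, b)\<bar> \<le> 1"
proof -
  show u: "u \<in> carrier_mat n n"
    using assms by (simp add: orthogonal_group_def)
  have *: "(\<Sum>l<n. u $$ (l, b) * u $$ (l, b')) = (if b = b' then 1 else 0)"
    if "b < n" "b' < n" for b b'
  proof -
    have "(transpose_mat u * u) $$ (b, b') = 1\<^sub>m n $$ (b, b')"
      using assms by (simp add: orthogonal_group_def)
    then show ?thesis
      using u that by (simp add: scalar_prod_def lessThan_atLeast0)
  qed
  then show "b < n \<Longrightarrow> b' < n \<Longrightarrow> (\<Sum>l<n. u $$ (l, b) * u $$ (l, b')) = (if b = b' then 1 else 0)" .
  show "\<bar>u $$ (a, b)\<bar> \<le> 1" if "a < n" "b < n"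
  proof -
    have "u $$ (a, b) * u $$ (a, b) \<le> (\<Sum>l<n. u $$ (l, b) * u $$ (l, b))"
      using that by (intro member_le_sum) auto
    then show ?thesis
      using *[of b b] that by (simp add: abs_square_le_1 flip: power2_eq_square)
  qed
qed

lemma orthogonal_group_mult:
  assumes "g \<in> orthogonal_group n" "u \<in> orthogonal_group n"
  shows "g * u \<in> orthogonal_group n"
proof -
  have c: "g \<in> carrier_mat n n" "u \<in> carrier_mat n n"
    and g: "g * transpose_mat g = 1\<^sub>m n" "transpose_mat g * g = 1\<^sub>m n"
    and u: "u * transpose_mat u = 1\<^sub>m n" "transpose_mat u * u = 1\<^sub>m n"
    using assms by (auto simp: orthogonal_group_def)
  have t: "transpose_mat (g * u) = transpose_mat u * transpose_mat g"
    by (rule transpose_mult[OF c])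
  have "g * u * (transpose_mat u * transpose_mat g) = g * (u * transpose_mat u) * transpose_mat g"
    using c by (simp add: assoc_mult_mat[of _ n n _ n _ n])
  moreover have "transpose_mat u * transpose_mat g * (g * u) = transpose_mat u * (transpose_mat g * g) * u"
    using c by (simp add: assoc_mult_mat[of _ n n _ n _ n])
  ultimately show ?thesis
    using c g u by (simp add: orthogonal_group_def t)
qed

text \<open>Rows \<open>a\<close> and \<open>l\<close> are written as sums of entries each supported
  in one column, so that \<open>sum.delta\<close> evaluates matrix products.\<close>

definition plane_rotation :: "nat \<Rightarrow> nat \<Rightarrow> nat \<Rightarrow> real \<Rightarrow> real mat" where
  "plane_rotation n a l t = mat n n (\<lambda>(r, c).
     if r = a then (if c = a then cos t else 0) + (if c = l then sin t else 0)
     else if r = l then (if c = l then cos t else 0) + (if c = a then - sin t else 0)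
     else (if c = r then 1 else 0))"

lemma plane_rotation_mult:
  assumes "u \<in> carrier_mat n n" "a < n" "l < n" "r < n" "c < n"
  shows "(plane_rotation n a l t * u) $$ (r, c) =
    (if r = a then cos t * u $$ (a, c) + sin t * u $$ (l, c)
     else if r = l then cos t * u $$ (l, c) - sin t * u $$ (a, c)
     else u $$ (r, c))"
  using assms
  by (simp add: plane_rotation_def scalar_prod_def distrib_right sum.distrib if_distribR
      if_distrib[of "\<lambda>x. x * _"] sum.delta cong: if_cong)

lemma plane_rotation_orthogonal:
  assumes "a < n" "l < n" "a \<noteq> l"
  shows "plane_rotation n a l t \<in> orthogonal_group n"
proof -
  have c: "plane_rotation n a l s \<in> carrier_mat n n" for s
    by (simp add: plane_rotation_def)
  have inv: "plane_rotation n a l s * plane_rotation n a l (- s) = 1\<^sub>m n" for s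
  proof (rule eq_matI)
    fix i j assume "i < dim_row (1\<^sub>m n :: real mat)" "j < dim_col (1\<^sub>m n :: real mat)"
    then have "i < n" "j < n" by simp_all
    moreover have "cos s * cos s + sin s * sin s = 1"
      using sin_cos_squared_add3[of s] by simp
    ultimately show "(plane_rotation n a l s * plane_rotation n a l (- s)) $$ (i, j) = 1\<^sub>m n $$ (i, j)"
      using assms by (subst plane_rotation_mult[OF c]) (auto simp: plane_rotation_def)
  qed (use c in \<open>auto simp: plane_rotation_def\<close>)
  have "transpose_mat (plane_rotation n a l t) = plane_rotation n a l (- t)"
    using assms by (intro eq_matI) (auto simp: plane_rotation_def)
  then show ?thesis
    using c inv[of t] inv[of "- t"] by (simp add: orthogonal_group_def)
qed

section \<open>Integration over the orthogonal group\<close>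

context
  fixes n :: nat and \<mu> :: "real mat measure"
  assumes haar: "normalized_haar n \<mu>"
begin

lemma haar_prob_space: "prob_space \<mu>"
  using haar by (simp add: normalized_haar_def)

lemma sets_haar: "sets \<mu> = sets (orthogonal_borel n)"
  using haar by (simp add: normalized_haar_def)

lemma space_haar: "space \<mu> = orthogonal_group n"
  using sets_eq_imp_space_eq[OF sets_haar] by (simp add: orthogonal_borel_def)

lemma measurable_haar_entry:
  assumes "a < n" "b < n"
  shows "(\<lambda>u. u $$ (a, b)) \<in> borel_measurable \<mu>"
proof -
  let ?f = "\<lambda>u :: real mat. restrict (\<lambda>ij. u $$ ij) ({..<n} \<times> {..<n})"
  have "?f \<in> measurable (orthogonal_borel n) (Pi\<^sub>M ({..<n} \<times> {..<n}) (\<lambda>_. borel))"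
    unfolding orthogonal_borel_def by (rule measurable_vimage_algebra1) (auto simp: space_PiM)
  then have "?f \<in> measurable \<mu> (Pi\<^sub>M ({..<n} \<times> {..<n}) (\<lambda>_. borel))"
    by (subst measurable_cong_sets[OF sets_haar refl])
  then have "(\<lambda>u. ?f u (a, b)) \<in> borel_measurable \<mu>"
    by (rule measurable_compose[OF _ measurable_component_singleton]) (use assms in auto)
  then show ?thesis using assms by simp
qed

lemma measurable_haar_mult:
  assumes g: "g \<in> orthogonal_group n"
  shows "(\<lambda>u. g * u) \<in> measurable \<mu> \<mu>"
proof -
  let ?f = "\<lambda>u :: real mat. restrict (\<lambda>ij. u $$ ij) ({..<n} \<times> {..<n})"
  have "(\<lambda>u. ?f (g * u)) \<in> measurable \<mu> (Pi\<^sub>M ({..<n} \<times> {..<n}) (\<lambda>_. borel))"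
  proof (rule measurable_restrict)
    fix ij assume "ij \<in> {..<n} \<times> {..<n}"
    then obtain a b where ij: "ij = (a, b)" "a < n" "b < n" by auto
    have "(\<lambda>u. \<Sum>l\<in>{0..<n}. g $$ (a, l) * u $$ (l, b)) \<in> borel_measurable \<mu>"
      by (intro borel_measurable_sum borel_measurable_times borel_measurable_const)
        (use ij in \<open>auto intro: measurable_haar_entry\<close>)
    moreover have "(g * u) $$ ij = (\<Sum>l\<in>{0..<n}. g $$ (a, l) * u $$ (l, b))" if "u \<in> space \<mu>" for u
      using orthogonal_groupD(1)[OF g] orthogonal_groupD(1)[of u n] that ij
      by (simp add: space_haar scalar_prod_def)
    ultimately show "(\<lambda>u. (g * u) $$ ij) \<in> borel_measurable \<mu>"
      by (simp cong: measurable_cong)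
  qed
  then have "(\<lambda>u. g * u) \<in> measurable \<mu> (orthogonal_borel n)"
    unfolding orthogonal_borel_def
    by (intro measurable_vimage_algebra2) (auto simp: space_haar orthogonal_group_mult[OF g])
  then show ?thesis
    by (subst measurable_cong_sets[OF refl sets_haar])
qed

lemma haar_left_invariant:
  fixes f :: "real mat \<Rightarrow> real"
  assumes "g \<in> orthogonal_group n" "f \<in> borel_measurable \<mu>"
  shows "(LINT u|\<mu>. f (g * u)) = (LINT u|\<mu>. f u)"
  using integral_distr[OF measurable_haar_mult[OF assms(1)] assms(2)] haar assms(1)
  by (simp add: normalized_haar_def)

lemma integrable_haar_bounded:
  fixes f :: "real mat \<Rightarrow> real"
  assumes "f \<in> borel_measurable \<mu>" "\<And>u. u \<in> orthogonal_group n \<Longrightarrow> \<bar>f u\<bar> \<le> 1"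
  shows "integrable \<mu> f"
proof -
  interpret prob_space \<mu> by (rule haar_prob_space)
  show ?thesis
    by (rule integrable_const_bound[where B = 1]) (use assms in \<open>auto simp: space_haar[symmetric]\<close>)
qed

lemma integrable_haar_prod:
  fixes f :: "'a \<Rightarrow> real mat \<Rightarrow> real"
  assumes "\<And>s. s \<in> S \<Longrightarrow> f s \<in> borel_measurable \<mu>"
    and "\<And>s u. s \<in> S \<Longrightarrow> u \<in> orthogonal_group n \<Longrightarrow> \<bar>f s u\<bar> \<le> 1"
  shows "integrable \<mu> (\<lambda>u. \<Prod>s\<in>S. f s u)"
  using assms by (intro integrable_haar_bounded borel_measurable_prod) (auto simp: abs_prod intro!: prod_le_1)

lemma integrable_haar_monomial:
  assumes "\<And>s. s \<in> S \<Longrightarrow> i s < n \<and> j s < n"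
  shows "integrable \<mu> (\<lambda>u. \<Prod>s\<in>S. u $$ (i s, j s))"
  using assms by (intro integrable_haar_prod) (auto intro: measurable_haar_entry orthogonal_groupD(3))

text \<open>The rotation by the angle \<open>t\<close> in the plane of the coordinates \<open>a\<close> and \<open>l\<close> does not change
  the integral of a monomial; this is the derivative of that identity at \<open>t = 0\<close>. To interchange it
  with the integral, the rotated monomial is expanded into finitely many monomials with coefficients
  depending on \<open>t\<close>.\<close>

lemma haar_infinitesimal_invariance:
  fixes i j :: "'a \<Rightarrow> nat"
  assumes "finite S" and ij: "\<And>s. s \<in> S \<Longrightarrow> i s < n \<and> j s < n"
    and al: "a < n" "l < n" "a \<noteq> l"
  defines "v \<equiv> \<lambda>m u. if i m = a then u $$ (l, j m) else if i m = l then - u $$ (a, j m) else 0"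
  shows "integrable \<mu> (\<lambda>u. \<Sum>m\<in>S. v m u * (\<Prod>s\<in>S - {m}. u $$ (i s, j s)))"
    and "(LINT u|\<mu>. (\<Sum>m\<in>S. v m u * (\<Prod>s\<in>S - {m}. u $$ (i s, j s)))) = 0"
proof -
  \<comment> \<open>For \<open>s \<in> S\<close>, rotation turns the entry at \<open>s\<close> into
    \<open>c s t * u $$ (i s, j s) + sin t * v s u\<close>. In the expansion, \<open>T\<close> is
    the set of factors that keep their own entry.\<close>
  define c where "c s t = (if i s = a \<or> i s = l then cos t else 1)" for s and t :: real
  define M where "M T u = (\<Prod>s\<in>T. u $$ (i s, j s)) * (\<Prod>s\<in>S - T. v s u)" for T u
  define \<kappa> where "\<kappa> T t = (\<Prod>s\<in>T. c s t) * (\<Prod>s\<in>S - T. sin t)" for T and t :: real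
  define D where "D u = (\<Sum>m\<in>S. v m u * (\<Prod>s\<in>S - {m}. u $$ (i s, j s)))" for u
  have v_meas: "v s \<in> borel_measurable \<mu>" if "s \<in> S" for s
  proof -
    have "(\<lambda>u. u $$ (l, j s)) \<in> borel_measurable \<mu>" "(\<lambda>u. - u $$ (a, j s)) \<in> borel_measurable \<mu>"
      using al ij[OF that] by (auto intro: measurable_haar_entry)
    then show ?thesis unfolding v_def by (cases "i s = a"; cases "i s = l") simp_all
  qed
  have v_bound: "\<bar>v s u\<bar> \<le> 1" if "s \<in> S" "u \<in> orthogonal_group n" for s u
    using al ij[OF that(1)] orthogonal_groupD(3)[OF that(2)] by (auto simp: v_def)
  have M_int: "integrable \<mu> (M T)" if "T \<subseteq> S" for T
  proof -
    have "integrable \<mu> (\<lambda>u. \<Prod>s\<in>S. if s \<in> T then u $$ (i s, j s) else v s u)"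
    proof (rule integrable_haar_prod)
      fix s assume "s \<in> S"
      then show "(\<lambda>u. if s \<in> T then u $$ (i s, j s) else v s u) \<in> borel_measurable \<mu>"
        using v_meas[of s] ij[of s] measurable_haar_entry[of "i s" "j s"] by (cases "s \<in> T") simp_all
    qed (use v_bound ij in \<open>auto intro: orthogonal_groupD(3)\<close>)
    moreover have "(\<Prod>s\<in>S. if s \<in> T then u $$ (i s, j s) else v s u) = M T u" for u
    proof -
      have "S \<inter> {s. s \<in> T} = T" "S \<inter> - {s. s \<in> T} = S - T" using that by auto
      then show ?thesis
        using assms(1) by (simp add: M_def prod.If_cases)
    qed
    ultimately show ?thesis by simp
  qed
  have expand: "(\<Prod>s\<in>S. c s t * u $$ (i s, j s) + sin t * v s u) = (\<Sum>T\<in>Pow S. \<kappa> T t * M T u)" for t u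
    by (subst prod_add[OF assms(1)]) (simp add: \<kappa>_def M_def prod.distrib mult_ac)
  have c0: "(c s has_real_derivative 0) (at 0)" for s
    unfolding c_def by (cases "i s = a \<or> i s = l") (auto intro!: derivative_eq_intros)
  have c1: "c s 0 = 1" for s
    by (simp add: c_def)
  \<comment> \<open>The value of the derivative is never computed. Differentiating the expanded
    product for fixed \<open>u\<close> identifies the combination of the \<open>k T\<close> with
    \<open>D u\<close>.\<close>
  have "\<exists>k. (\<kappa> T has_real_derivative k) (at 0)" for T
    unfolding \<kappa>_def
    by (rule exI, rule DERIV_mult[OF has_field_derivative_prod[where f = c and f' = "\<lambda>_. 0"]
            has_field_derivative_prod[where f = "\<lambda>_. sin" and f' = "\<lambda>_. cos 0"]])
      (auto intro!: derivative_eq_intros c0)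
  then obtain k where k: "(\<kappa> T has_real_derivative k T) (at 0)" for T
    by metis
  have D: "D u = (\<Sum>T\<in>Pow S. k T * M T u)" for u
  proof -
    have "((\<lambda>t. \<Prod>s\<in>S. c s t * u $$ (i s, j s) + sin t * v s u) has_real_derivative
        (\<Sum>m\<in>S. v m u * (\<Prod>s\<in>S - {m}. c s 0 * u $$ (i s, j s) + sin 0 * v s u))) (at 0)"
      by (rule has_field_derivative_prod) (auto intro!: derivative_eq_intros c0)
    then have "((\<lambda>t. \<Sum>T\<in>Pow S. \<kappa> T t * M T u) has_real_derivative D u) (at 0)"
      by (simp add: expand D_def c1)
    moreover have "((\<lambda>t. \<Sum>T\<in>Pow S. \<kappa> T t * M T u) has_real_derivative (\<Sum>T\<in>Pow S. k T * M T u)) (at 0)"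
      by (intro DERIV_sum DERIV_cmult_right k)
    ultimately show ?thesis by (rule DERIV_unique)
  qed
  \<comment> \<open>The left side is the integral of the rotated monomial, hence constant in
    \<open>t\<close>. Its derivative at \<open>0\<close> is therefore zero.\<close>
  have "(\<Sum>T\<in>Pow S. \<kappa> T t * (LINT u|\<mu>. M T u)) = (LINT u|\<mu>. (\<Prod>s\<in>S. u $$ (i s, j s)))" for t
  proof -
    let ?g = "plane_rotation n a l t"
    have "(LINT u|\<mu>. (\<Prod>s\<in>S. u $$ (i s, j s))) = (LINT u|\<mu>. (\<Prod>s\<in>S. (?g * u) $$ (i s, j s)))"
      by (rule haar_left_invariant[symmetric, OF plane_rotation_orthogonal[OF al]])
        (rule borel_measurable_integrable[OF integrable_haar_monomial[OF ij]])
    also have "\<dots> = (LINT u|\<mu>. (\<Sum>T\<in>Pow S. \<kappa> T t * M T u))"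
    proof (rule Bochner_Integration.integral_cong)
      fix u assume "u \<in> space \<mu>"
      then have u: "u \<in> carrier_mat n n"
        by (simp add: space_haar orthogonal_group_def)
      have "(?g * u) $$ (i s, j s) = c s t * u $$ (i s, j s) + sin t * v s u" if "s \<in> S" for s
        using plane_rotation_mult[OF u al(1,2)] ij[OF that] al by (auto simp: c_def v_def)
      then show "(\<Prod>s\<in>S. (?g * u) $$ (i s, j s)) = (\<Sum>T\<in>Pow S. \<kappa> T t * M T u)"
        by (simp flip: expand)
    qed simp
    also have "\<dots> = (\<Sum>T\<in>Pow S. \<kappa> T t * (LINT u|\<mu>. M T u))"
      by (subst Bochner_Integration.integral_sum) (auto intro: M_int)
    finally show ?thesis by simp
  qed
  then have "((\<lambda>t. \<Sum>T\<in>Pow S. \<kappa> T t * (LINT u|\<mu>. M T u)) has_real_derivative 0) (at 0)"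
    by simp
  moreover have "((\<lambda>t. \<Sum>T\<in>Pow S. \<kappa> T t * (LINT u|\<mu>. M T u)) has_real_derivative
      (\<Sum>T\<in>Pow S. k T * (LINT u|\<mu>. M T u))) (at 0)"
    by (intro DERIV_sum DERIV_cmult_right k)
  ultimately have 0: "(\<Sum>T\<in>Pow S. k T * (LINT u|\<mu>. M T u)) = 0"
    by (rule DERIV_unique[symmetric])
  show "integrable \<mu> (\<lambda>u. \<Sum>m\<in>S. v m u * (\<Prod>s\<in>S - {m}. u $$ (i s, j s)))"
    unfolding D_def[symmetric] D by (intro Bochner_Integration.integrable_sum integrable_mult_right M_int) auto
  show "(LINT u|\<mu>. (\<Sum>m\<in>S. v m u * (\<Prod>s\<in>S - {m}. u $$ (i s, j s)))) = 0"
    unfolding D_def[symmetric] D 0[symmetric]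
    by (subst Bochner_Integration.integral_sum) (auto intro: M_int)
qed

text \<open>Move position \<open>x\<close> to a row \<open>l\<close> different from
  \<open>i x\<close>, apply infinitesimal invariance in the plane of \<open>i x\<close> and
  \<open>l\<close>, and sum over \<open>l\<close>. The factor at \<open>x\<close> returns to its row
  and gives \<open>-(n - 1)\<close> times the moment. The other factors give the transposed moments
  with negative sign and, by column orthogonality, the contracted moments.\<close>

lemma haar_schwinger_dyson:
  fixes i j :: "'a \<Rightarrow> nat"
  assumes "finite S" "x \<in> S" and ij: "\<And>s. s \<in> S \<Longrightarrow> i s < n \<and> j s < n"
  shows "(real n - 1) * (LINT u|\<mu>. (\<Prod>s\<in>S. u $$ (i s, j s)))
      + (\<Sum>m\<in>S - {x}. LINT u|\<mu>. (\<Prod>s\<in>S. u $$ (i s, (j \<circ> Transposition.transpose x m) s)))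
    = (\<Sum>m\<in>S - {x}. if i x = i m \<and> j x = j m
        then (LINT u|\<mu>. (\<Prod>s\<in>S - {x, m}. u $$ (i s, j s))) else 0)"
proof -
  let ?S = "S - {x}"
  define v where "v l m u = (if (i(x := l)) m = i x then u $$ (l, j m)
    else if (i(x := l)) m = l then - u $$ (i x, j m) else 0)" for l m and u :: "real mat"
  define D where "D l u = (\<Sum>m\<in>S. v l m u * (\<Prod>s\<in>S - {m}. u $$ ((i(x := l)) s, j s)))" for l u
  define F where "F u = (\<Prod>s\<in>S. u $$ (i s, j s))" for u :: "real mat"
  define G where "G m u = (\<Prod>s\<in>S. u $$ (i s, (j \<circ> Transposition.transpose x m) s))" for m and u :: "real mat"
  define R where "R m u = (\<Prod>s\<in>S - {x, m}. u $$ (i s, j s))" for m and u :: "real mat"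
  define e where "e m = (if i x = i m \<and> j x = j m then 1 else 0 :: real)" for m
  have inv: "integrable \<mu> (D l)" "(LINT u|\<mu>. D l u) = 0" if "l \<in> {..<n} - {i x}" for l
  proof -
    have ij': "\<And>s. s \<in> S \<Longrightarrow> (i(x := l)) s < n \<and> j s < n"
      using ij that by auto
    have "i x < n" "l < n" "i x \<noteq> l"
      using ij[OF assms(2)] that by auto
    note * = haar_infinitesimal_invariance[of S "i(x := l)" j, OF assms(1) ij' this]
    show "integrable \<mu> (D l)"
      unfolding D_def v_def by (rule *(1))
    show "(LINT u|\<mu>. D l u) = 0"
      unfolding D_def v_def by (rule *(2))
  qed
  have int: "integrable \<mu> F" "\<And>m. m \<in> ?S \<Longrightarrow> integrable \<mu> (G m)" "\<And>m. integrable \<mu> (R m)"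
    unfolding F_def G_def R_def
    by (rule integrable_haar_monomial; use assms in \<open>auto simp: Transposition.transpose_def\<close>)+
  have key: "(\<Sum>l\<in>{..<n} - {i x}. D l u) = (\<Sum>m\<in>?S. e m * R m u) - (real n - 1) * F u - (\<Sum>m\<in>?S. G m u)"
    if u: "u \<in> space \<mu>" for u
  proof -
    have orth: "(\<Sum>l<n. u $$ (l, j m) * u $$ (l, j x)) = (if j x = j m then 1 else 0)" if "m \<in> ?S" for m
      using orthogonal_groupD(2)[of u n "j m" "j x"] u ij assms(2) that by (auto simp: space_haar)
    have D: "D l u = - F u + (\<Sum>m\<in>?S. v l m u * u $$ (l, j x) * R m u)" if "l \<in> {..<n} - {i x}" for l
    proof -
      have "D l u = v l x u * (\<Prod>s\<in>?S. u $$ ((i(x := l)) s, j s))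
          + (\<Sum>m\<in>?S. v l m u * (\<Prod>s\<in>S - {m}. u $$ ((i(x := l)) s, j s)))"
        unfolding D_def by (rule sum.remove) fact+
      also have "v l x u * (\<Prod>s\<in>?S. u $$ ((i(x := l)) s, j s)) = - (u $$ (i x, j x) * (\<Prod>s\<in>?S. u $$ (i s, j s)))"
        using that by (auto simp: v_def intro!: prod.cong)
      also have "\<dots> = - F u"
        unfolding F_def using assms by (subst (2) prod.remove[of _ x]) auto
      also have "(\<Sum>m\<in>?S. v l m u * (\<Prod>s\<in>S - {m}. u $$ ((i(x := l)) s, j s)))
          = (\<Sum>m\<in>?S. v l m u * u $$ (l, j x) * R m u)"
      proof (intro sum.cong refl)
        fix m assume m: "m \<in> ?S"
        have "(\<Prod>s\<in>S - {m}. u $$ ((i(x := l)) s, j s)) =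
            u $$ (l, j x) * (\<Prod>s\<in>S - {m} - {x}. u $$ ((i(x := l)) s, j s))"
          using assms m by (subst prod.remove[of _ x]) auto
        also have "S - {m} - {x} = S - {x, m}" by auto
        also have "(\<Prod>s\<in>S - {x, m}. u $$ ((i(x := l)) s, j s)) = R m u"
          unfolding R_def by (intro prod.cong) auto
        finally show "v l m u * (\<Prod>s\<in>S - {m}. u $$ ((i(x := l)) s, j s)) = v l m u * u $$ (l, j x) * R m u"
          by simp
      qed
      finally show ?thesis .
    qed
    have G: "G m u = u $$ (i x, j m) * u $$ (i m, j x) * R m u" if m: "m \<in> ?S" for m
    proof -
      have "G m u = u $$ (i x, j m) * (\<Prod>s\<in>?S. u $$ (i s, (j \<circ> Transposition.transpose x m) s))"
        unfolding G_def using assms by (subst prod.remove[of _ x]) auto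
      also have "(\<Prod>s\<in>?S. u $$ (i s, (j \<circ> Transposition.transpose x m) s)) =
          u $$ (i m, j x) * (\<Prod>s\<in>?S - {m}. u $$ (i s, (j \<circ> Transposition.transpose x m) s))"
        using assms m by (subst prod.remove[of _ m]) auto
      also have "(\<Prod>s\<in>?S - {m}. u $$ (i s, (j \<circ> Transposition.transpose x m) s)) = R m u"
        unfolding R_def by (rule prod.cong) (auto simp: Transposition.transpose_def)
      finally show ?thesis by simp
    qed
    \<comment> \<open>If \<open>m\<close> lies in row \<open>i x\<close>, all \<open>l\<close>
      contribute, and orthogonality applies once the missing term \<open>l = i x\<close> is
      restored. Otherwise only \<open>l = i m\<close> contributes.\<close>
    have V: "(\<Sum>l\<in>{..<n} - {i x}. v l m u * u $$ (l, j x)) = e m - u $$ (i x, j m) * u $$ (i m, j x)"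
      if m: "m \<in> ?S" for m
    proof (cases "i m = i x")
      case True
      then have "(\<Sum>l\<in>{..<n} - {i x}. v l m u * u $$ (l, j x)) =
          (\<Sum>l\<in>{..<n} - {i x}. u $$ (l, j m) * u $$ (l, j x))"
        using m by (intro sum.cong) (auto simp: v_def)
      also have "\<dots> = (\<Sum>l<n. u $$ (l, j m) * u $$ (l, j x)) - u $$ (i x, j m) * u $$ (i x, j x)"
        using ij[OF assms(2)] by (subst sum_diff1) auto
      finally show ?thesis
        using True orth[OF m] by (simp add: e_def)
    next
      case False
      then have "(\<Sum>l\<in>{..<n} - {i x}. v l m u * u $$ (l, j x)) =
          (\<Sum>l\<in>{..<n} - {i x}. if l = i m then - u $$ (i x, j m) * u $$ (i m, j x) else 0)"
        using m by (intro sum.cong) (auto simp: v_def)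
      also have "\<dots> = - u $$ (i x, j m) * u $$ (i m, j x)"
        using ij[of m] m False by (subst sum.delta) auto
      finally show ?thesis
        using False by (simp add: e_def)
    qed
    have "(\<Sum>l\<in>{..<n} - {i x}. D l u) =
        - (real n - 1) * F u + (\<Sum>l\<in>{..<n} - {i x}. \<Sum>m\<in>?S. v l m u * u $$ (l, j x) * R m u)"
      using ij[OF assms(2)] by (simp add: D sum_subtractf of_nat_diff left_diff_distrib)
    also have "(\<Sum>l\<in>{..<n} - {i x}. \<Sum>m\<in>?S. v l m u * u $$ (l, j x) * R m u) =
        (\<Sum>m\<in>?S. (\<Sum>l\<in>{..<n} - {i x}. v l m u * u $$ (l, j x)) * R m u)"
      by (subst sum.swap) (simp add: sum_distrib_right)
    also have "\<dots> = (\<Sum>m\<in>?S. e m * R m u - G m u)"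
      by (intro sum.cong refl) (simp add: V G algebra_simps)
    finally show ?thesis
      by (simp add: sum_subtractf left_diff_distrib)
  qed
  have "0 = (\<Sum>l\<in>{..<n} - {i x}. LINT u|\<mu>. D l u)"
    by (simp add: inv)
  also have "\<dots> = (LINT u|\<mu>. (\<Sum>l\<in>{..<n} - {i x}. D l u))"
    by (rule Bochner_Integration.integral_sum[symmetric]) (rule inv)
  also have "\<dots> = (LINT u|\<mu>. (\<Sum>m\<in>?S. e m * R m u) - (real n - 1) * F u - (\<Sum>m\<in>?S. G m u))"
    by (rule Bochner_Integration.integral_cong) (simp_all add: key)
  also have "\<dots> = (\<Sum>m\<in>?S. e m * (LINT u|\<mu>. R m u)) - (real n - 1) * (LINT u|\<mu>. F u) - (\<Sum>m\<in>?S. LINT u|\<mu>. G m u)"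
  proof -
    have eR: "integrable \<mu> (\<lambda>u. e m * R m u)" for m
      by (intro integrable_mult_right int(3))
    have 1: "integrable \<mu> (\<lambda>u. \<Sum>m\<in>?S. e m * R m u)" "integrable \<mu> (\<lambda>u. (real n - 1) * F u)"
      "integrable \<mu> (\<lambda>u. \<Sum>m\<in>?S. G m u)"
      using int eR by (intro Bochner_Integration.integrable_sum integrable_mult_right; simp)+
    have 2: "(LINT u|\<mu>. (\<Sum>m\<in>?S. e m * R m u)) = (\<Sum>m\<in>?S. e m * (LINT u|\<mu>. R m u))"
      by (subst Bochner_Integration.integral_sum) (simp_all add: int(3))
    have 3: "(LINT u|\<mu>. (\<Sum>m\<in>?S. G m u)) = (\<Sum>m\<in>?S. LINT u|\<mu>. G m u)"
      by (rule Bochner_Integration.integral_sum) (rule int(2))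
    show ?thesis
      by (simp only: Bochner_Integration.integral_diff[OF Bochner_Integration.integrable_diff[OF 1(1,2)] 1(3)]
          Bochner_Integration.integral_diff[OF 1(1,2)] 2 3 integral_mult_right_zero)
  qed
  also have "(\<Sum>m\<in>?S. e m * (LINT u|\<mu>. R m u)) = (\<Sum>m\<in>?S. if i x = i m \<and> j x = j m then LINT u|\<mu>. R m u else 0)"
    by (intro sum.cong) (auto simp: e_def)
  finally show ?thesis
    unfolding F_def G_def R_def by linarith
qed

end

section \<open>Expansion of moments over matchings\<close>

text \<open>A matching is an involution whose moved points are exactly those of \<open>S\<close>. In
  this form, adding or deleting a pair can be checked pointwise.\<close>

lemma matchings_iff: "\<sigma> \<in> matchings S \<longleftrightarrow> (\<forall>z. \<sigma> (\<sigma> z) = z) \<and> (\<forall>z. \<sigma> z \<noteq> z \<longleftrightarrow> z \<in> S)"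
proof
  assume "\<sigma> \<in> matchings S"
  note M = matchingsD[OF this]
  show "(\<forall>z. \<sigma> (\<sigma> z) = z) \<and> (\<forall>z. \<sigma> z \<noteq> z \<longleftrightarrow> z \<in> S)"
  proof (intro conjI allI)
    fix z
    show "\<sigma> (\<sigma> z) = z" by (rule M(1))
    show "\<sigma> z \<noteq> z \<longleftrightarrow> z \<in> S" by (cases "z \<in> S") (simp_all add: M(3,4))
  qed
next
  assume *: "(\<forall>z. \<sigma> (\<sigma> z) = z) \<and> (\<forall>z. \<sigma> z \<noteq> z \<longleftrightarrow> z \<in> S)"
  have "\<sigma> permutes S"
    unfolding permutes_def
  proof (intro conjI allI impI)
    fix y show "\<exists>!z. \<sigma> z = y"
      by (rule ex1I[of _ "\<sigma> y"]) (use * in auto)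
  qed (use * in blast)
  then show "\<sigma> \<in> matchings S"
    using * by (simp add: matchings_def)
qed

text \<open>Multiplication by the transposition of \<open>x\<close> and its partner makes both
  points fixed and leaves the other pairs alone. The same multiplication puts the pair back.\<close>

lemma remove_pair_matchings:
  assumes "\<sigma> \<in> matchings S" "x \<in> S"
  shows "\<sigma> \<circ> Transposition.transpose x (\<sigma> x) \<in> matchings (S - {x, \<sigma> x})"
proof -
  note M = matchingsD[OF assms(1)]
  have eq: "(\<sigma> \<circ> Transposition.transpose x (\<sigma> x)) z = (if z = x \<or> z = \<sigma> x then z else \<sigma> z)" for z
    by (simp add: Transposition.transpose_def M)
  have ne: "\<sigma> z \<noteq> x" "\<sigma> z \<noteq> \<sigma> x" if "z \<noteq> x" "z \<noteq> \<sigma> x" for z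
    using that M(1)[of z] M(1)[of x] by (intro notI; simp)+
  show ?thesis
    unfolding matchings_iff eq using ne M(3,4) by (auto simp: M(1))
qed

lemma add_pair_matchings:
  assumes "\<tau> \<in> matchings (S - {x, m})" "x \<in> S" "m \<in> S" "x \<noteq> m"
  shows "\<tau> \<circ> Transposition.transpose x m \<in> matchings S"
proof -
  note M = matchingsD[OF assms(1)]
  have fixed: "\<tau> x = x" "\<tau> m = m" using M(4) by auto
  have eq: "(\<tau> \<circ> Transposition.transpose x m) z = (if z = x then m else if z = m then x else \<tau> z)" for z
    by (simp add: Transposition.transpose_def fixed)
  have ne: "\<tau> z \<noteq> x" "\<tau> z \<noteq> m" if "z \<noteq> x" "z \<noteq> m" for z
    using that M(1)[of z] fixed by (intro notI; simp)+
  show ?thesis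
    unfolding matchings_iff eq using ne M(3,4) assms(2-4) by (auto simp: M(1))
qed

text \<open>The condition expressed by the delta symbol of a pairing in Weingarten calculus.\<close>

definition constant_on_pairs :: "'a set \<Rightarrow> ('a \<Rightarrow> 'b) \<Rightarrow> ('a \<Rightarrow> 'a) \<Rightarrow> bool" where
  "constant_on_pairs S j \<sigma> \<longleftrightarrow> (\<forall>s\<in>S. j (\<sigma> s) = j s)"

lemma constant_on_pairs_relabel:
  assumes "x \<in> S" "m \<in> S"
  shows "constant_on_pairs S (j \<circ> Transposition.transpose x m) (relabel x m \<sigma>) \<longleftrightarrow> constant_on_pairs S j \<sigma>"
proof -
  let ?t = "Transposition.transpose x m"
  have "?t ` S = S"
    using permutes_image[OF permutes_swap_id[OF assms]] .
  then have "constant_on_pairs S j \<sigma> \<longleftrightarrow> (\<forall>s\<in>?t ` S. j (\<sigma> s) = j s)"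
    by (simp add: constant_on_pairs_def)
  then show ?thesis
    by (simp add: constant_on_pairs_def relabel_def)
qed

lemma constant_on_pairs_remove:
  assumes "\<sigma> \<in> matchings S" "x \<in> S"
  shows "constant_on_pairs S j \<sigma> \<longleftrightarrow> j x = j (\<sigma> x) \<and>
    constant_on_pairs (S - {x, \<sigma> x}) j (\<sigma> \<circ> Transposition.transpose x (\<sigma> x))"
proof -
  note M = matchingsD[OF assms(1)]
  have "(\<sigma> \<circ> Transposition.transpose x (\<sigma> x)) s = \<sigma> s" if "s \<in> S - {x, \<sigma> x}" for s
    using that by auto
  then have 1: "constant_on_pairs (S - {x, \<sigma> x}) j (\<sigma> \<circ> Transposition.transpose x (\<sigma> x)) \<longleftrightarrow>
      (\<forall>s\<in>S - {x, \<sigma> x}. j (\<sigma> s) = j s)"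
    by (simp add: constant_on_pairs_def)
  have S: "S = insert x (insert (\<sigma> x) (S - {x, \<sigma> x}))"
    using assms(2) M(2)[of x] by auto
  show ?thesis
    unfolding 1 by (subst S) (auto simp: constant_on_pairs_def M(1))
qed

text \<open>At \<open>y = 1 - n\<close> the divisor \<open>c - y\<close> is
  \<open>n - (1 - c)\<close>, so each root \<open>c\<close> adds at most the pole
  \<open>1 - c\<close>. All other operations are differences, finite sums and integer
  multiples.\<close>

lemma resolvent_rational:
  assumes "x \<in> S" "\<And>c. c \<in> set cs \<Longrightarrow> 1 - c \<in> B"
    and "\<And>\<sigma>. \<sigma> \<in> matchings S \<Longrightarrow> rational_with_poles_in B (\<lambda>n. f n \<sigma>)"
    and "\<sigma> \<in> matchings S"
  shows "rational_with_poles_in B (\<lambda>n. resolvent (jucys_murphy S x) (1 - real n) cs (f n) \<sigma>)"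
  using assms(2-)
proof (induction cs arbitrary: f \<sigma>)
  case Nil
  then show ?case using rational_with_poles_in_of_int[of B 0] by simp
next
  case (Cons c cs)
  let ?K = "jucys_murphy S x"
  have "rational_with_poles_in B (\<lambda>n. (?K (f n) - of_int c * f n) \<tau>)" if \<tau>: "\<tau> \<in> matchings S" for \<tau>
  proof -
    have "rational_with_poles_in B (\<lambda>n. ?K (f n) \<tau>)"
      unfolding jucys_murphy_def
      by (rule rational_with_poles_in_sum, rule Cons.prems(2), rule relabel_matchings)
        (use \<tau> assms(1) in auto)
    then have "rational_with_poles_in B (\<lambda>n. ?K (f n) \<tau> - of_int c * f n \<tau>)"
      by (rule rational_with_poles_in_diff) (rule rational_with_poles_in_mult_of_int[OF Cons.prems(2)[OF \<tau>]])
    then show ?thesis by (simp add: of_int_fun_apply)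
  qed
  then have "rational_with_poles_in B
      (\<lambda>n. resolvent ?K (1 - real n) cs (?K (f n) - of_int c * f n) \<sigma>)"
    by (intro Cons.IH Cons.prems) (simp_all add: Cons.prems)
  then have *: "rational_with_poles_in B
      (\<lambda>n. (f n \<sigma> - resolvent ?K (1 - real n) cs (?K (f n) - of_int c * f n) \<sigma>) / (real n - of_int (1 - c)))"
    by (intro rational_with_poles_in_divide rational_with_poles_in_diff Cons.prems) (simp_all add: Cons.prems)
  have "real n - of_int (1 - c) = of_int c - (1 - real n)" for n
    by simp
  with * show ?case by (simp only: resolvent.simps)
qed

text \<open>Diagonal dominance: where \<open>\<bar>\<Delta>\<bar>\<close> is largest,
  \<open>card S - 1\<close> transposed values cannot balance \<open>n - 1\<close> times the
  maximum.\<close>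

lemma transposition_sum_eq_0:
  fixes \<Delta> :: "('a \<Rightarrow> nat) \<Rightarrow> real"
  assumes "finite S" "x \<in> S" "card S < n"
    and eq: "\<And>j. (\<forall>s\<in>S. j s < n) \<Longrightarrow>
      (real n - 1) * \<Delta> j + (\<Sum>m\<in>S - {x}. \<Delta> (j \<circ> Transposition.transpose x m)) = 0"
    and j: "\<forall>s\<in>S. j s < n"
  shows "\<Delta> j = 0"
proof -
  \<comment> \<open>The maximum is taken over the rearrangements of \<open>j\<close>, a finite set
    that is closed under the transpositions in question.\<close>
  define Orb where "Orb = (\<lambda>\<pi>. j \<circ> \<pi>) ` {\<pi>. \<pi> permutes S}"
  have Orb: "finite Orb" "j \<in> Orb"
    unfolding Orb_def using finite_permutations[OF assms(1)] by (auto intro!: image_eqI[of _ _ id] permutes_id)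
  define M where "M = Max ((\<lambda>j. \<bar>\<Delta> j\<bar>) ` Orb)"
  have le: "\<bar>\<Delta> l\<bar> \<le> M" if "l \<in> Orb" for l
    unfolding M_def using Orb that by (intro Max_ge) auto
  have "M \<in> (\<lambda>j. \<bar>\<Delta> j\<bar>) ` Orb"
    unfolding M_def using Orb by (intro Max_in) auto
  then obtain \<pi> where \<pi>: "\<pi> permutes S" and M: "M = \<bar>\<Delta> (j \<circ> \<pi>)\<bar>"
    by (auto simp: Orb_def)
  have "\<forall>s\<in>S. (j \<circ> \<pi>) s < n"
    using j permutes_in_image[OF \<pi>] by simp
  from eq[OF this] have "(real n - 1) * \<Delta> (j \<circ> \<pi>) = - (\<Sum>m\<in>S - {x}. \<Delta> (j \<circ> \<pi> \<circ> Transposition.transpose x m))"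
    by linarith
  then have "\<bar>(real n - 1) * \<Delta> (j \<circ> \<pi>)\<bar> = \<bar>\<Sum>m\<in>S - {x}. \<Delta> (j \<circ> \<pi> \<circ> Transposition.transpose x m)\<bar>"
    by simp
  then have "(real n - 1) * M = \<bar>\<Sum>m\<in>S - {x}. \<Delta> (j \<circ> \<pi> \<circ> Transposition.transpose x m)\<bar>"
    using assms(3) by (simp add: abs_mult M)
  also have "\<dots> \<le> (\<Sum>m\<in>S - {x}. \<bar>\<Delta> (j \<circ> \<pi> \<circ> Transposition.transpose x m)\<bar>)"
    by (rule sum_abs)
  also have "\<dots> \<le> (\<Sum>m\<in>S - {x}. M)"
  proof (rule sum_mono)
    fix m assume "m \<in> S - {x}"
    then have "\<pi> \<circ> Transposition.transpose x m permutes S"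
      using assms(2) by (intro permutes_compose[OF _ \<pi>] permutes_swap_id) auto
    then show "\<bar>\<Delta> (j \<circ> \<pi> \<circ> Transposition.transpose x m)\<bar> \<le> M"
      by (intro le) (auto simp: Orb_def comp_assoc)
  qed
  also have "\<dots> = (real (card S) - 1) * M"
    using assms(1,2) card_gt_0_iff[of S] by (subst sum_constant) (auto simp: of_nat_diff)
  finally have "(real n - real (card S)) * M \<le> 0"
    by (simp add: algebra_simps)
  then have "M \<le> 0"
    using assms(3) by (simp add: mult_le_0_iff)
  then show ?thesis using le[OF Orb(2)] by simp
qed

text \<open>Relabelling the matchings shifts the transpositions from \<open>j\<close> to
  \<open>W\<close>, so that \<open>c + J\<close> acts on the coefficients. The resulting sum is then
  grouped by the partner \<open>m\<close> of \<open>x\<close>, and the pair of \<open>x\<close> and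
  \<open>m\<close> is deleted.\<close>

lemma sum_matchings_recursion:
  fixes i j :: "'a \<Rightarrow> nat" and W :: "('a \<Rightarrow> 'a) \<Rightarrow> real"
  assumes "finite S" "x \<in> S"
    and W: "\<And>\<sigma>. \<sigma> \<in> matchings S \<Longrightarrow> c * W \<sigma> + jucys_murphy S x W \<sigma> =
      (if i x = i (\<sigma> x) then V (\<sigma> x) (\<sigma> \<circ> Transposition.transpose x (\<sigma> x)) else 0)"
  defines "\<Phi> \<equiv> \<lambda>j. \<Sum>\<sigma>\<in>matchings S. if constant_on_pairs S j \<sigma> then W \<sigma> else 0"
  shows "c * \<Phi> j + (\<Sum>m\<in>S - {x}. \<Phi> (j \<circ> Transposition.transpose x m)) =
    (\<Sum>m\<in>S - {x}. if i x = i m \<and> j x = j m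
       then (\<Sum>\<tau>\<in>matchings (S - {x, m}). if constant_on_pairs (S - {x, m}) j \<tau> then V m \<tau> else 0) else 0)"
proof -
  let ?M = "matchings S" and ?t = "Transposition.transpose x"
  have fin: "finite ?M" by (rule finite_matchings[OF assms(1)])
  have "\<Phi> (j \<circ> ?t m) = (\<Sum>\<sigma>\<in>?M. if constant_on_pairs S j \<sigma> then W (relabel x m \<sigma>) else 0)"
    if "m \<in> S - {x}" for m
    unfolding \<Phi>_def
  proof (rule sum.reindex_bij_witness[of _ "relabel x m" "relabel x m"])
    fix \<sigma>
    show "(if constant_on_pairs S j (relabel x m \<sigma>) then W (relabel x m (relabel x m \<sigma>)) else 0) =
        (if constant_on_pairs S (j \<circ> ?t m) \<sigma> then W \<sigma> else 0)"
      using constant_on_pairs_relabel[of x S m j "relabel x m \<sigma>"] that assms(2) by simp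
  qed (use that assms(2) in \<open>auto simp: relabel_matchings\<close>)
  then have "(\<Sum>m\<in>S - {x}. \<Phi> (j \<circ> ?t m)) =
      (\<Sum>m\<in>S - {x}. \<Sum>\<sigma>\<in>?M. if constant_on_pairs S j \<sigma> then W (relabel x m \<sigma>) else 0)"
    by simp
  also have "\<dots> = (\<Sum>\<sigma>\<in>?M. if constant_on_pairs S j \<sigma> then jucys_murphy S x W \<sigma> else 0)"
    by (subst sum.swap) (auto simp: jucys_murphy_def intro!: sum.cong)
  finally have "c * \<Phi> j + (\<Sum>m\<in>S - {x}. \<Phi> (j \<circ> ?t m)) =
      (\<Sum>\<sigma>\<in>?M. if constant_on_pairs S j \<sigma> then c * W \<sigma> + jucys_murphy S x W \<sigma> else 0)"
    by (simp add: \<Phi>_def sum_distrib_left flip: sum.distrib) (intro sum.cong; simp)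
  also have "\<dots> = (\<Sum>\<sigma>\<in>?M. if constant_on_pairs S j \<sigma> \<and> i x = i (\<sigma> x)
      then V (\<sigma> x) (\<sigma> \<circ> ?t (\<sigma> x)) else 0)" (is "_ = (\<Sum>\<sigma>\<in>?M. ?h \<sigma>)")
    by (intro sum.cong) (auto simp: W)
  also have "\<dots> = (\<Sum>m\<in>S - {x}. \<Sum>\<sigma>\<in>{\<sigma>\<in>?M. \<sigma> x = m}. ?h \<sigma>)"
    using assms(1,2) by (intro sum.group[symmetric] fin) (auto simp: matchingsD)
  also have "\<dots> = (\<Sum>m\<in>S - {x}. if i x = i m \<and> j x = j m
       then (\<Sum>\<tau>\<in>matchings (S - {x, m}). if constant_on_pairs (S - {x, m}) j \<tau> then V m \<tau> else 0) else 0)"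
  proof (intro sum.cong refl)
    fix m assume m: "m \<in> S - {x}"
    have tt: "\<sigma> \<circ> ?t m \<circ> ?t m = \<sigma>" for \<sigma> :: "'a \<Rightarrow> 'a"
      by (simp add: fun_eq_iff)
    have "(\<Sum>\<sigma>\<in>{\<sigma>\<in>?M. \<sigma> x = m}. ?h \<sigma>) = (\<Sum>\<tau>\<in>matchings (S - {x, m}).
      if i x = i m \<and> j x = j m \<and> constant_on_pairs (S - {x, m}) j \<tau> then V m \<tau> else 0)"
    proof (rule sum.reindex_bij_witness[of _ "\<lambda>\<tau>. \<tau> \<circ> ?t m" "\<lambda>\<sigma>. \<sigma> \<circ> ?t m"])
      fix \<sigma> assume \<sigma>: "\<sigma> \<in> {\<sigma> \<in> ?M. \<sigma> x = m}"
      show "\<sigma> \<circ> ?t m \<in> matchings (S - {x, m})"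
        using remove_pair_matchings[of \<sigma> S x] \<sigma> assms(2) by auto
      show "(if i x = i m \<and> j x = j m \<and> constant_on_pairs (S - {x, m}) j (\<sigma> \<circ> ?t m)
          then V m (\<sigma> \<circ> ?t m) else 0) = ?h \<sigma>"
        using constant_on_pairs_remove[of \<sigma> S x j] \<sigma> assms(2) by auto
    next
      fix \<tau> assume \<tau>: "\<tau> \<in> matchings (S - {x, m})"
      then have "\<tau> m = m" using matchingsD(4)[OF \<tau>] by simp
      then show "\<tau> \<circ> ?t m \<in> {\<sigma> \<in> ?M. \<sigma> x = m}"
        using add_pair_matchings[OF \<tau>] m assms(2) by auto
    qed (simp_all only: tt)
    then show "(\<Sum>\<sigma>\<in>{\<sigma>\<in>?M. \<sigma> x = m}. ?h \<sigma>) = (if i x = i m \<and> j x = j m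
       then (\<Sum>\<tau>\<in>matchings (S - {x, m}). if constant_on_pairs (S - {x, m}) j \<tau> then V m \<tau> else 0) else 0)"
      by (cases "i x = i m"; cases "j x = j m") simp_all
  qed
  finally show ?thesis .
qed

text \<open>The coefficients may depend on the fixed rows \<open>i\<close> but not on the columns
  \<open>j\<close>. All \<open>j\<close> with values below \<open>n\<close> are treated at once,
  because the moment equation relates \<open>j\<close> to its rearrangements.\<close>

lemma haar_moment_matchings:
  fixes i :: "'a \<Rightarrow> nat"
  assumes haar: "\<forall>\<^sub>F n in sequentially. normalized_haar n (\<mu> n)"
    and "finite S" "card S = 2 * k"
  shows "\<exists>V. (\<forall>\<sigma>\<in>matchings S. rational_with_poles_in {- 2 * int k..int k - 1} (\<lambda>n. V n \<sigma>)) \<and>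
    (\<forall>\<^sub>F n in sequentially. \<forall>j. (\<forall>s\<in>S. j s < n) \<longrightarrow>
      (LINT u|\<mu> n. (\<Prod>s\<in>S. u $$ (i s, j s))) =
      (\<Sum>\<sigma>\<in>matchings S. if constant_on_pairs S j \<sigma> then V n \<sigma> else 0))"
  using assms(2,3)
proof (induction k arbitrary: S)
  case 0
  then have S: "S = {}" by simp
  have M: "matchings ({} :: 'a set) = {id}"
    by (auto simp: matchings_iff fun_eq_iff)
  have "\<forall>\<^sub>F n in sequentially. (LINT u|\<mu> n. 1 :: real) = 1"
    using haar by eventually_elim (simp add: normalized_haar_def prob_space.prob_space)
  then show ?case
    unfolding S M using rational_with_poles_in_of_int[of _ 1]
    by (intro exI[of _ "\<lambda>n \<sigma>. 1"]) (simp add: constant_on_pairs_def)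
next
  case (Suc k)
  obtain x where x: "x \<in> S"
    using Suc.prems by fastforce
  let ?S = "S - {x}" and ?K = "jucys_murphy S x" and ?B = "{- 2 * int (Suc k)..int (Suc k) - 1}"
  define E where "E m V \<longleftrightarrow> (\<forall>\<sigma>\<in>matchings (S - {x, m}). rational_with_poles_in {- 2 * int k..int k - 1} (\<lambda>n. V n \<sigma>)) \<and>
    (\<forall>\<^sub>F n in sequentially. \<forall>j. (\<forall>s\<in>S - {x, m}. j s < n) \<longrightarrow>
      (LINT u|\<mu> n. (\<Prod>s\<in>S - {x, m}. u $$ (i s, j s))) =
      (\<Sum>\<sigma>\<in>matchings (S - {x, m}). if constant_on_pairs (S - {x, m}) j \<sigma> then V n \<sigma> else 0))"
    for m and V :: "nat \<Rightarrow> ('a \<Rightarrow> 'a) \<Rightarrow> real"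
  have "\<forall>m\<in>?S. \<exists>V. E m V"
    unfolding E_def
  proof (intro ballI Suc.IH)
    fix m assume "m \<in> ?S"
    then show "finite (S - {x, m})" "card (S - {x, m}) = 2 * k"
      using Suc.prems x by (auto simp: card_Diff_subset card_insert_if)
  qed
  then obtain V where V: "\<And>m. m \<in> ?S \<Longrightarrow> E m (V m)"
    by metis
  \<comment> \<open>The coefficient side of the contracted moments: the condition on
    \<open>i\<close> goes into \<open>R\<close>, the condition on \<open>j\<close> remains in
    \<open>constant_on_pairs\<close>.\<close>
  define R where "R n \<sigma> = (if i x = i (\<sigma> x) then V (\<sigma> x) n (\<sigma> \<circ> Transposition.transpose x (\<sigma> x)) else 0)" for n \<sigma>
  obtain cs0 where cs0: "set cs0 \<subseteq> {- int (card S - 1)..int (card S - 1)}"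
    and ann0: "\<And>f. annihilate ?K cs0 f = 0"
    using jucys_murphy_integral_spectrum[OF Suc.prems(1) x] by blast
  define cs where "cs = filter (\<lambda>c. 2 - int (Suc k) \<le> c) cs0"
  have ann: "annihilate ?K cs f \<sigma> = 0" if "\<sigma> \<in> matchings S" for f \<sigma>
    unfolding cs_def by (rule annihilate_jucys_murphy_filter[OF Suc.prems(1) x Suc.prems(2) _ that]) (simp add: ann0)
  \<comment> \<open>These bounds place \<open>1 - c\<close> between \<open>- 2 * k\<close> and
    \<open>k\<close>, hence in \<open>?B\<close>.\<close>
  have cs: "2 - int (Suc k) \<le> c" "c \<le> 2 * int (Suc k) - 1" if "c \<in> set cs" for c
    using that subsetD[OF cs0, of c] Suc.prems(2) by (auto simp: cs_def)
  define W where "W n = resolvent ?K (1 - real n) cs (R n)" for n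
  have R: "rational_with_poles_in ?B (\<lambda>n. R n \<sigma>)" if \<sigma>: "\<sigma> \<in> matchings S" for \<sigma>
  proof (cases "i x = i (\<sigma> x)")
    case True
    have "\<sigma> x \<in> ?S" using matchingsD[OF \<sigma>] x by auto
    then have "rational_with_poles_in {- 2 * int k..int k - 1} (\<lambda>n. V (\<sigma> x) n (\<sigma> \<circ> Transposition.transpose x (\<sigma> x)))"
      using V[of "\<sigma> x"] remove_pair_matchings[OF \<sigma> x] by (simp add: E_def)
    then have "rational_with_poles_in ?B (\<lambda>n. V (\<sigma> x) n (\<sigma> \<circ> Transposition.transpose x (\<sigma> x)))"
      by (rule rational_with_poles_in_mono) auto
    then show ?thesis using True by (simp add: R_def)
  next
    case False
    then show ?thesis using rational_with_poles_in_of_int[of ?B 0] by (simp add: R_def)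
  qed
  have W_rational: "rational_with_poles_in ?B (\<lambda>n. W n \<sigma>)" if "\<sigma> \<in> matchings S" for \<sigma>
    unfolding W_def by (rule resolvent_rational[OF x _ R that]) (auto dest: cs)
  have "\<forall>\<^sub>F n in sequentially. \<forall>m\<in>?S. \<forall>j. (\<forall>s\<in>S - {x, m}. j s < n) \<longrightarrow>
      (LINT u|\<mu> n. (\<Prod>s\<in>S - {x, m}. u $$ (i s, j s))) =
      (\<Sum>\<sigma>\<in>matchings (S - {x, m}). if constant_on_pairs (S - {x, m}) j \<sigma> then V m n \<sigma> else 0)"
    using V Suc.prems(1) by (intro eventually_ball_finite) (auto simp: E_def)
  moreover have "\<forall>\<^sub>F n in sequentially. card S < n"
    by (rule eventually_gt_at_top)
  moreover have "\<forall>\<^sub>F n in sequentially. \<forall>s\<in>S. i s < n"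
    using Suc.prems(1) by (intro eventually_ball_finite) (auto intro: eventually_gt_at_top)
  ultimately have "\<forall>\<^sub>F n in sequentially. \<forall>j. (\<forall>s\<in>S. j s < n) \<longrightarrow>
      (LINT u|\<mu> n. (\<Prod>s\<in>S. u $$ (i s, j s))) =
      (\<Sum>\<sigma>\<in>matchings S. if constant_on_pairs S j \<sigma> then W n \<sigma> else 0)"
    using haar
  proof eventually_elim
    case (elim n)
    define F where "F j = (LINT u|\<mu> n. (\<Prod>s\<in>S. u $$ (i s, j s)))" for j
    define \<Phi> where "\<Phi> j = (\<Sum>\<sigma>\<in>matchings S. if constant_on_pairs S j \<sigma> then W n \<sigma> else 0)" for j :: "'a \<Rightarrow> nat"
    \<comment> \<open>The remaining roots exceed \<open>1 - n\<close> once
      \<open>n > card S\<close>, so no division by zero occurs.\<close>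
    have "of_int c \<noteq> 1 - real n" if "c \<in> set cs" for c
    proof -
      have "Suc k < n"
        using elim(2) Suc.prems(2) by simp
      then have "1 - int n < c"
        using cs(1)[OF that] by linarith
      then show ?thesis by linarith
    qed
    then have W_eq: "(real n - 1) * W n \<sigma> + ?K (W n) \<sigma> = R n \<sigma>" if "\<sigma> \<in> matchings S" for \<sigma>
      using resolvent_jucys_murphy[of cs "1 - real n" "matchings S" S x "R n" \<sigma>] ann that
      by (simp add: W_def algebra_simps)
    \<comment> \<open>The moments and the matching sums satisfy the same equation, so their
      difference solves the homogeneous one.\<close>
    have "(real n - 1) * (F j - \<Phi> j) +
        (\<Sum>m\<in>?S. F (j \<circ> Transposition.transpose x m) - \<Phi> (j \<circ> Transposition.transpose x m)) = 0"
      if j: "\<forall>s\<in>S. j s < n" for j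
    proof -
      have "(real n - 1) * F j + (\<Sum>m\<in>?S. F (j \<circ> Transposition.transpose x m)) =
        (\<Sum>m\<in>?S. if i x = i m \<and> j x = j m
          then (LINT u|\<mu> n. (\<Prod>s\<in>S - {x, m}. u $$ (i s, j s))) else 0)"
        unfolding F_def by (rule haar_schwinger_dyson[OF elim(4) Suc.prems(1) x]) (use elim(3) j in auto)
      also have "\<dots> = (\<Sum>m\<in>?S. if i x = i m \<and> j x = j m
          then (\<Sum>\<tau>\<in>matchings (S - {x, m}). if constant_on_pairs (S - {x, m}) j \<tau> then V m n \<tau> else 0) else 0)"
        using elim(1) j by (intro sum.cong) auto
      also have "\<dots> = (real n - 1) * \<Phi> j + (\<Sum>m\<in>?S. \<Phi> (j \<circ> Transposition.transpose x m))"
        unfolding \<Phi>_def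
        by (rule sum_matchings_recursion[symmetric, OF Suc.prems(1) x]) (simp add: W_eq R_def)
      finally show ?thesis
        by (simp add: sum_subtractf algebra_simps)
    qed
    then have "F j - \<Phi> j = 0" if "\<forall>s\<in>S. j s < n" for j
      using transposition_sum_eq_0[OF Suc.prems(1) x elim(2), of "\<lambda>j. F j - \<Phi> j"] that by blast
    then show ?case by (simp add: F_def \<Phi>_def)
  qed
  then show ?case using W_rational by blast
qed

section \<open>The poles of \<open>I(a)\<close>\<close>

theorem corollary6p2:
  fixes p q k :: nat
    and a :: "nat mat"
    and \<mu> :: "nat \<Rightarrow> real mat measure"
    and z :: complex
  assumes "p > 0" and "q > 0"
    and "a \<in> carrier_mat p q"
    and "admissible a"
    and "k = (\<Sum>i<p. \<Sum>j<q. a $$ (i, j)) div 2"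
    and "\<And>n. n \<ge> max p q \<Longrightarrow> normalized_haar n (\<mu> n)"
    and "is_pole (ratfun_eval (haar_moment_ratfun \<mu> a)) z"
  shows "z \<in> of_int ` {- 2 * int k .. int k - 1}"
proof -
  \<comment> \<open>Each exponent is unfolded into that many distinct positions
    \<open>(i, j, t)\<close>, so the monomial becomes a product of single entries over
    \<open>S\<close>.\<close>
  define S where "S = (SIGMA i:{..<p}. SIGMA j:{..<q}. {..<a $$ (i, j)})"
  let ?i = "\<lambda>s :: nat \<times> nat \<times> nat. fst s" and ?j = "\<lambda>s :: nat \<times> nat \<times> nat. fst (snd s)"
  have fin: "finite S" by (simp add: S_def)
  have dim: "dim_row a = p" "dim_col a = q"
    using assms(3) by auto
  \<comment> \<open>Even row sums make the total even, so the halving in \<open>k\<close> is exact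
    and \<open>S\<close> has \<open>2 * k\<close> elements.\<close>
  have "even (\<Sum>i<p. \<Sum>j<q. a $$ (i, j))"
    by (rule dvd_sum) (use assms(4) in \<open>auto simp: admissible_def dim\<close>)
  then have card: "card S = 2 * k"
    by (simp add: S_def assms(5))
  have haar: "\<forall>\<^sub>F n in sequentially. normalized_haar n (\<mu> n)"
    using eventually_ge_at_top[of "max p q"] by eventually_elim (rule assms(6))
  obtain V where V: "\<And>\<sigma>. \<sigma> \<in> matchings S \<Longrightarrow> rational_with_poles_in {- 2 * int k..int k - 1} (\<lambda>n. V n \<sigma>)"
    and eq: "\<forall>\<^sub>F n in sequentially. \<forall>j. (\<forall>s\<in>S. j s < n) \<longrightarrow>
      (LINT u|\<mu> n. (\<Prod>s\<in>S. u $$ (?i s, j s))) =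
      (\<Sum>\<sigma>\<in>matchings S. if constant_on_pairs S j \<sigma> then V n \<sigma> else 0)"
    using haar_moment_matchings[OF haar fin card, of ?i] by blast
  let ?f = "\<lambda>n. \<Sum>\<sigma>\<in>matchings S. if constant_on_pairs S ?j \<sigma> then V n \<sigma> else 0"
  have "rational_with_poles_in {- 2 * int k..int k - 1} (\<lambda>n. if constant_on_pairs S ?j \<sigma> then V n \<sigma> else 0)"
    if "\<sigma> \<in> matchings S" for \<sigma>
    using V[OF that] rational_with_poles_in_of_int[of _ 0]
    by (cases "constant_on_pairs S ?j \<sigma>") simp_all
  then have "rational_with_poles_in {- 2 * int k..int k - 1} ?f"
    by (rule rational_with_poles_in_sum)
  moreover have "\<forall>\<^sub>F n in sequentially. ?f n = haar_moment (\<mu> n) a"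
    using eq eventually_ge_at_top[of q]
  proof eventually_elim
    case (elim n)
    have "\<forall>s\<in>S. ?j s < n" using elim(2) by (auto simp: S_def)
    then have "?f n = (LINT u|\<mu> n. (\<Prod>s\<in>S. u $$ (?i s, ?j s)))"
      using elim(1) by simp
    moreover have "(\<Prod>s\<in>S. u $$ (?i s, ?j s)) = (\<Prod>i<p. \<Prod>j<q. u $$ (i, j) ^ (a $$ (i, j)))" for u :: "real mat"
    proof -
      have "(\<Prod>i<p. \<Prod>j<q. u $$ (i, j) ^ (a $$ (i, j))) =
          (\<Prod>i<p. \<Prod>j<q. \<Prod>t<a $$ (i, j). u $$ (i, j))"
        by simp
      also have "\<dots> = (\<Prod>i<p. \<Prod>(j, t)\<in>(SIGMA j:{..<q}. {..<a $$ (i, j)}). u $$ (i, j))"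
        by (intro prod.cong refl prod.Sigma) auto
      also have "\<dots> = (\<Prod>s\<in>S. u $$ (?i s, ?j s))"
        unfolding S_def by (subst prod.Sigma) (auto simp: case_prod_beta)
      finally show ?thesis by simp
    qed
    then have "(LINT u|\<mu> n. (\<Prod>s\<in>S. u $$ (?i s, ?j s))) = haar_moment (\<mu> n) a"
      by (simp add: haar_moment_def dim)
    ultimately show ?case by simp
  qed
  ultimately show ?thesis
    using poles_of_haar_moment_ratfun assms(7) by blast
qed

end
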